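(* Let $G$ be a strongly topological gyrogroup and let $H$ be a closed neutral strong subgyrogroup of $G$. If $G/H$ has the Baire property (i.e. $G/H$ is a Baire space), then the following are equivalent: (1) $G/H$ is metrizable; (2) $G/H$ has the strong Pytkeev property; (3) $G/H$ has countable $ck$-character; (4) $G/H$ has countable $cn$-character; (5) $G/H$ has an $\omega^\omega$-base satisfying the condition $(\mathbf{D})$.
   Context: A gyrogroup is a nonempty set $G$ with a binary operation $\oplus$ such that: (G1) there is $0\in G$ with $0\oplus x=x=x\oplus 0$ for all $x\in G$; (G2) each $x\in G$ has an inverse $\ominus x\in G$ with $\ominus x\oplus x=0=x\oplus(\ominus x)$; (G3) for all $x,y\in G$ there is an automorphism $\mathrm{gyr}[x,y]$ of $(G,\oplus)$ (a bijection preserving $\oplus$) with $x\oplus(y\oplus z)=(x\oplus y)\oplus \mathrm{gyr}[x,y](z)$ for all $z\in G$; (G4) $\mathrm{gyr}[x\oplus y,y]=\mathrm{gyr}[x,y]$ for all $x,y\in G$. For $A,B\subseteq G$, $A\oplus B=\{a\oplus b:a\in A,b\in B\}$ and $\ominus A=\{\ominus a:a\in A\}$. A subset $A\subseteq G$ is gyr-invariant if $\mathrm{gyr}[x,y](A)=A$ for all $x,y\in G$. A subgyrogroup is a nonempty $H\subseteq G$ closed under $\oplus$ and $\ominus$; it is strong if it is gyr-invariant. A topological gyrogroup is a gyrogroup with a topology for which $\oplus:G\times G\to G$ and $\ominus:G\to G$ are continuous; it is strongly topological if every neighborhood of $0$ contains a gyr-invariant neighborhood of $0$. A subgyrogroup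 $H$ is neutral if for every neighborhood $U$ of $0$ there are open neighborhoods $V,V'$ of $0$ with $H\oplus V\subseteq U\oplus H$ and $V'\oplus H\subseteq H\oplus U$. For a strong subgyrogroup $H$, $G/H=\{a\oplus H:a\in G\}$ is a partition of $G$ and carries the quotient topology of the map $a\mapsto a\oplus H$. No separation axiom is assumed unless stated. Let $X$ be a space and $x\in X$. Strong Pytkeev property: for each $x\in X$ there is a countable family $\mathcal D$ of subsets of $X$ such that for each neighborhood $U$ of $x$ and each $A\subseteq X$ with $x\in\overline{A}\setminus A$ there is $D\in\mathcal D$ with $D\subseteq U$ and $D\cap A$ infinite. A family $\mathcal N$ of subsets of $X$ is a $cn$-network at $x$ if for each neighborhood $O_x$ of $x$ the set $\bigcup\{N\in\mathcal N: x\in N\subseteq O_x\}$ is a neighborhood of $x$. It is a $ck$-network at $x$ if for each neighborhood $O_x$ of $x$ there is a neighborhood $U_x$ of $x$ such that for each compact $K\subseteq U_x$ there is a finite subfamily $\mathcal F\subseteq\mathcal N$ with $x\in\bigcap\mathcal F$ and $K\subseteq\bigcup\mathcal F\subseteq O_x$. $X$ has countable $cn$-character (resp. $ck$-character) if it has a countable $cn$-network (resp. $ck$-network) at each of its points. Order $\mathbb N^{\mathbb N}$ by $\alpha\le\beta$ iff $\alpha_i\le\beta_i$ for all $i$. $X$ has an $\omega^\omega$-base if each $x\in X$ has a neighborhood base of the form $\mathcal U=\{U_\alpha(x):\alpha\in\mathbb N^{\mathbb N}\}$ with $U_\beta(x)\subseteq U_\alpha(x)$ whenever $\alpha\le\beta$.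 For $\alpha\in\mathbb N^{\mathbb N}$, $k\in\mathbb N$ let $I_k(\alpha)=\{\beta\in\mathbb N^{\mathbb N}:\beta_i=\alpha_i \text{ for } i=1,\dots,k\}$ and $D_k(\alpha)=\bigcap_{\beta\in I_k(\alpha)}U_\beta(x)$. The family $\mathcal U$ satisfies condition $(\mathbf D)$ if $U_\alpha(x)=\bigcup_{k\in\mathbb N}D_k(\alpha)$ for every $\alpha\in\mathbb N^{\mathbb N}$; the $\omega^\omega$-base satisfies $(\mathbf D)$ if these families do at each point $x$. *)

theory Defs
  imports "HOL-Analysis.Analysis"
begin

section \<open>Gyrogroups\<close>

text \<open>The values of \<^term>\<open>gyr\<close> matter only on the carrier: both the automorphism property and the
  equality of maps in the loop law are relativised to it.\<close>

locale gyrogroup =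
  fixes G :: "'a set"
    and add :: "'a \<Rightarrow> 'a \<Rightarrow> 'a" (infixl "\<oplus>" 65)
    and zero :: "'a"
    and neg :: "'a \<Rightarrow> 'a"
    and gyr :: "'a \<Rightarrow> 'a \<Rightarrow> 'a \<Rightarrow> 'a"
  assumes add_closed: "\<lbrakk>x \<in> G; y \<in> G\<rbrakk> \<Longrightarrow> x \<oplus> y \<in> G"
    and zero_closed: "zero \<in> G"
    and left_zero: "x \<in> G \<Longrightarrow> zero \<oplus> x = x"
    and right_zero: "x \<in> G \<Longrightarrow> x \<oplus> zero = x"
    and neg_closed: "x \<in> G \<Longrightarrow> neg x \<in> G"
    and left_neg: "x \<in> G \<Longrightarrow> neg x \<oplus> x = zero"
    and right_neg: "x \<in> G \<Longrightarrow> x \<oplus> neg x = zero"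
    and gyr_bij: "\<lbrakk>x \<in> G; y \<in> G\<rbrakk> \<Longrightarrow> bij_betw (gyr x y) G G"
    and gyr_hom: "\<lbrakk>x \<in> G; y \<in> G; a \<in> G; b \<in> G\<rbrakk> \<Longrightarrow> gyr x y (a \<oplus> b) = gyr x y a \<oplus> gyr x y b"
    and left_gyroassoc:
      "\<lbrakk>x \<in> G; y \<in> G; z \<in> G\<rbrakk> \<Longrightarrow> x \<oplus> (y \<oplus> z) = (x \<oplus> y) \<oplus> gyr x y z"
    and left_loop: "\<lbrakk>x \<in> G; y \<in> G; z \<in> G\<rbrakk> \<Longrightarrow> gyr (x \<oplus> y) y z = gyr x y z"

definition set_add :: "('a \<Rightarrow> 'a \<Rightarrow> 'a) \<Rightarrow> 'a set \<Rightarrow> 'a set \<Rightarrow> 'a set" where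
  "set_add add A B = {add a b | a b. a \<in> A \<and> b \<in> B}"

definition left_coset :: "('a \<Rightarrow> 'a \<Rightarrow> 'a) \<Rightarrow> 'a set \<Rightarrow> 'a \<Rightarrow> 'a set" where
  "left_coset add H a = {add a h | h. h \<in> H}"

definition gyr_invariant :: "'a set \<Rightarrow> ('a \<Rightarrow> 'a \<Rightarrow> 'a \<Rightarrow> 'a) \<Rightarrow> 'a set \<Rightarrow> bool" where
  "gyr_invariant G gyr A \<longleftrightarrow> A \<subseteq> G \<and> (\<forall>x\<in>G. \<forall>y\<in>G. gyr x y ` A = A)"

definition subgyrogroup ::
    "'a set \<Rightarrow> ('a \<Rightarrow> 'a \<Rightarrow> 'a) \<Rightarrow> ('a \<Rightarrow> 'a) \<Rightarrow> 'a set \<Rightarrow> bool" where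
  "subgyrogroup G add neg H \<longleftrightarrow>
     H \<noteq> {} \<and> H \<subseteq> G \<and> (\<forall>x\<in>H. \<forall>y\<in>H. add x y \<in> H) \<and> (\<forall>x\<in>H. neg x \<in> H)"

definition strong_subgyrogroup ::
    "'a set \<Rightarrow> ('a \<Rightarrow> 'a \<Rightarrow> 'a) \<Rightarrow> ('a \<Rightarrow> 'a) \<Rightarrow> ('a \<Rightarrow> 'a \<Rightarrow> 'a \<Rightarrow> 'a) \<Rightarrow> 'a set \<Rightarrow> bool" where
  "strong_subgyrogroup G add neg gyr H \<longleftrightarrow> subgyrogroup G add neg H \<and> gyr_invariant G gyr H"


section \<open>Topological gyrogroups and their coset spaces\<close>

text \<open>Neighbourhoods need not be open.\<close>

definition neighbourhood_of :: "'a topology \<Rightarrow> 'a \<Rightarrow> 'a set \<Rightarrow> bool" where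
  "neighbourhood_of X x U \<longleftrightarrow> U \<subseteq> topspace X \<and> (\<exists>W. openin X W \<and> x \<in> W \<and> W \<subseteq> U)"

locale topological_gyrogroup =
  gyrogroup "topspace T" add zero neg gyr
  for T :: "'a topology"
    and add :: "'a \<Rightarrow> 'a \<Rightarrow> 'a" (infixl "\<oplus>" 65)
    and zero neg gyr +
  assumes continuous_add: "continuous_map (prod_topology T T) T (\<lambda>(x, y). x \<oplus> y)"
    and continuous_neg: "continuous_map T T neg"

locale strongly_topological_gyrogroup =
  topological_gyrogroup T add zero neg gyr
  for T :: "'a topology"
    and add :: "'a \<Rightarrow> 'a \<Rightarrow> 'a" (infixl "\<oplus>" 65)
    and zero neg gyr +
  assumes gyr_invariant_neighbourhood:
    "neighbourhood_of T zero U \<Longrightarrow>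
       \<exists>V. neighbourhood_of T zero V \<and> gyr_invariant (topspace T) gyr V \<and> V \<subseteq> U"

definition neutral_in :: "'a topology \<Rightarrow> ('a \<Rightarrow> 'a \<Rightarrow> 'a) \<Rightarrow> 'a \<Rightarrow> 'a set \<Rightarrow> bool" where
  "neutral_in T add zero H \<longleftrightarrow>
     (\<forall>U. neighbourhood_of T zero U \<longrightarrow>
        (\<exists>V V'. openin T V \<and> zero \<in> V \<and> openin T V' \<and> zero \<in> V' \<and>
           set_add add H V \<subseteq> set_add add U H \<and> set_add add V' H \<subseteq> set_add add H U))"

definition quotient_topology :: "'a topology \<Rightarrow> ('a \<Rightarrow> 'b) \<Rightarrow> 'b topology" where
  "quotient_topology X f =
     topology (\<lambda>W. W \<subseteq> f ` topspace X \<and> openin X {x \<in> topspace X. f x \<in> W})"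

lemma openin_quotient_topology:
  "openin (quotient_topology X f) W \<longleftrightarrow>
     W \<subseteq> f ` topspace X \<and> openin X {x \<in> topspace X. f x \<in> W}"
proof -
  let ?P = "\<lambda>W. W \<subseteq> f ` topspace X \<and> openin X {x \<in> topspace X. f x \<in> W}"
  have "istopology ?P"
    unfolding istopology_def
  proof (intro conjI allI impI)
    fix S S' assume S: "?P S" and S': "?P S'"
    show "S \<inter> S' \<subseteq> f ` topspace X" using S by blast
    have "{x \<in> topspace X. f x \<in> S \<inter> S'} =
        {x \<in> topspace X. f x \<in> S} \<inter> {x \<in> topspace X. f x \<in> S'}" by blast
    then show "openin X {x \<in> topspace X. f x \<in> S \<inter> S'}" using S S' by (simp add: openin_Int)
  next
    fix \<K> assume K: "\<forall>K\<in>\<K>. ?P K"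
    show "\<Union>\<K> \<subseteq> f ` topspace X" using K by blast
    have "{x \<in> topspace X. f x \<in> \<Union>\<K>} = (\<Union>K\<in>\<K>. {x \<in> topspace X. f x \<in> K})" by blast
    moreover have "openin X (\<Union>K\<in>\<K>. {x \<in> topspace X. f x \<in> K})"
      using K by (intro openin_Union) auto
    ultimately show "openin X {x \<in> topspace X. f x \<in> \<Union>\<K>}" by simp
  qed
  then show ?thesis
    by (simp add: quotient_topology_def topology_inverse')
qed

lemma topspace_quotient_topology [simp]: "topspace (quotient_topology X f) = f ` topspace X"
proof
  show "topspace (quotient_topology X f) \<subseteq> f ` topspace X"
    using openin_topspace [of "quotient_topology X f"]
    unfolding openin_quotient_topology by (rule conjunct1)
  have "{x \<in> topspace X. f x \<in> f ` topspace X} = topspace X" by blast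
  then have "openin (quotient_topology X f) (f ` topspace X)"
    by (simp add: openin_quotient_topology)
  then show "f ` topspace X \<subseteq> topspace (quotient_topology X f)"
    by (rule openin_subset)
qed

lemma quotient_map_quotient_topology: "quotient_map X (quotient_topology X f) f"
  unfolding quotient_map_def openin_quotient_topology topspace_quotient_topology by blast

definition coset_space :: "'a topology \<Rightarrow> ('a \<Rightarrow> 'a \<Rightarrow> 'a) \<Rightarrow> 'a set \<Rightarrow> 'a set topology" where
  "coset_space T add H = quotient_topology T (left_coset add H)"


section \<open>Properties of topological spaces\<close>

text \<open>The intersection with the whole space only matters for the empty family.\<close>

definition baire_space :: "'a topology \<Rightarrow> bool" where
  "baire_space X \<longleftrightarrow>
     (\<forall>\<G>. countable \<G> \<and> (\<forall>W\<in>\<G>. openin X W \<and> X closure_of W = topspace X) \<longrightarrow>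
        X closure_of (topspace X \<inter> \<Inter>\<G>) = topspace X)"

definition strong_Pytkeev_property :: "'a topology \<Rightarrow> bool" where
  "strong_Pytkeev_property X \<longleftrightarrow>
     (\<forall>x\<in>topspace X. \<exists>\<D>. countable \<D> \<and> \<D> \<subseteq> Pow (topspace X) \<and>
        (\<forall>U A. neighbourhood_of X x U \<and> A \<subseteq> topspace X \<and> x \<in> X closure_of A - A \<longrightarrow>
           (\<exists>D\<in>\<D>. D \<subseteq> U \<and> infinite (D \<inter> A))))"

definition cn_network_at :: "'a topology \<Rightarrow> 'a \<Rightarrow> 'a set set \<Rightarrow> bool" where
  "cn_network_at X x \<N> \<longleftrightarrow>
     \<N> \<subseteq> Pow (topspace X) \<and>
     (\<forall>U. neighbourhood_of X x U \<longrightarrow> neighbourhood_of X x (\<Union>{N \<in> \<N>. x \<in> N \<and> N \<subseteq> U}))"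

definition ck_network_at :: "'a topology \<Rightarrow> 'a \<Rightarrow> 'a set set \<Rightarrow> bool" where
  "ck_network_at X x \<N> \<longleftrightarrow>
     \<N> \<subseteq> Pow (topspace X) \<and>
     (\<forall>V. neighbourhood_of X x V \<longrightarrow>
        (\<exists>U. neighbourhood_of X x U \<and>
           (\<forall>K. compactin X K \<and> K \<subseteq> U \<longrightarrow>
              (\<exists>\<F>. finite \<F> \<and> \<F> \<subseteq> \<N> \<and> x \<in> \<Inter>\<F> \<and> K \<subseteq> \<Union>\<F> \<and> \<Union>\<F> \<subseteq> V))))"

definition countable_cn_character :: "'a topology \<Rightarrow> bool" where
  "countable_cn_character X \<longleftrightarrow> (\<forall>x\<in>topspace X. \<exists>\<N>. countable \<N> \<and> cn_network_at X x \<N>)"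

definition countable_ck_character :: "'a topology \<Rightarrow> bool" where
  "countable_ck_character X \<longleftrightarrow> (\<forall>x\<in>topspace X. \<exists>\<N>. countable \<N> \<and> ck_network_at X x \<N>)"

text \<open>The order on \<^typ>\<open>nat \<Rightarrow> nat\<close> is the library's pointwise order.\<close>

definition omega_base_at :: "'a topology \<Rightarrow> 'a \<Rightarrow> ((nat \<Rightarrow> nat) \<Rightarrow> 'a set) \<Rightarrow> bool" where
  "omega_base_at X x U \<longleftrightarrow>
     (\<forall>\<alpha>. neighbourhood_of X x (U \<alpha>)) \<and>
     (\<forall>V. neighbourhood_of X x V \<longrightarrow> (\<exists>\<alpha>. U \<alpha> \<subseteq> V)) \<and>
     (\<forall>\<alpha> \<beta>. \<alpha> \<le> \<beta> \<longrightarrow> U \<beta> \<subseteq> U \<alpha>)"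

text \<open>Coordinates are numbered from 0, so the first \<^term>\<open>k\<close> coordinates are those below
  \<^term>\<open>k\<close>. Allowing \<^prop>\<open>k = 0\<close> does not affect condition (D), since the set
  \<open>prefix_Inter U k \<alpha>\<close> increases with \<^term>\<open>k\<close>.\<close>

definition same_prefix :: "nat \<Rightarrow> (nat \<Rightarrow> nat) \<Rightarrow> (nat \<Rightarrow> nat) set" where
  "same_prefix k \<alpha> = {\<beta>. \<forall>i<k. \<beta> i = \<alpha> i}"

definition prefix_Inter :: "((nat \<Rightarrow> nat) \<Rightarrow> 'a set) \<Rightarrow> nat \<Rightarrow> (nat \<Rightarrow> nat) \<Rightarrow> 'a set" where
  "prefix_Inter U k \<alpha> = (\<Inter>\<beta>\<in>same_prefix k \<alpha>. U \<beta>)"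

definition condition_D :: "((nat \<Rightarrow> nat) \<Rightarrow> 'a set) \<Rightarrow> bool" where
  "condition_D U \<longleftrightarrow> (\<forall>\<alpha>. U \<alpha> = (\<Union>k. prefix_Inter U k \<alpha>))"

definition has_omega_base_D :: "'a topology \<Rightarrow> bool" where
  "has_omega_base_D X \<longleftrightarrow> (\<forall>x\<in>topspace X. \<exists>U. omega_base_at X x U \<and> condition_D U)"

end

theory Submission
  imports Defs
begin

text \<open>The proof passes through countable \<open>cn\<close>-character at the single point \<open>H\<close>. A metrizable space has
a countable decreasing base at each point, and this gives all the other conditions. Conversely, each
of the conditions yields a countable \<open>cn\<close>-network at \<open>H\<close>: singletons are compact, so a
\<open>ck\<close>-network is a \<open>cn\<close>-network; if the members of a strong Pytkeev family lying in \<open>U\<close> did not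
cover a neighbourhood of the point, the complement of their union would accumulate there without meeting
any of them; and the sets \<open>D\<^sub>k(\<alpha>)\<close> of condition (D) depend only on finite prefixes, so they are
countably many.

It remains to metrize \<open>G/H\<close> from a countable \<open>cn\<close>-network at \<open>H\<close> and the Baire property. Sums of
gyr-invariant sets are associative, so neighbourhoods of \<open>0\<close> can be handled as in a group as long as
only invariant ones are used. For an invariant symmetric neighbourhood \<open>U\<close> of \<open>0\<close> let
\<open>S U = H \<oplus> (U \<oplus> H)\<close>. The relations \<open>\<ominus>a \<oplus> b \<in> S U\<close> respect cosets, and they form a base of a
uniformity: for composition, \<open>S V \<oplus> S V = H \<oplus> V \<oplus> H \<oplus> V \<oplus> H\<close>, and neutrality moves the middle
\<open>H\<close> to the right past \<open>V\<close>, at the cost of enlarging \<open>V\<close> (\<open>saturation_halve\<close>). Neutrality also shows that this uniformity induces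
the quotient topology (\<open>openin_coset_space_iff\<close>). The space is \<open>T\<^sub>1\<close> because \<open>H\<close> is closed, so by
Frink's chain construction (\<open>metrizable_space_entourages\<close>) it is metrizable as soon as countably many
of the sets \<open>S U\<close> are cofinal.

This last point is where the Baire property enters (\<open>metrizable_of_cn_network\<close>). Given \<open>U\<close>, take \<open>V\<close>
with \<open>S V \<oplus> S V \<oplus> S V \<oplus> S V \<subseteq> S U\<close>. The network members \<open>N\<close> inside the image of \<open>S V\<close> cover a
neighbourhood of \<open>H\<close>, so one of them has a closure with nonempty interior. The differences \<open>\<ominus>p \<oplus> q\<close> of
elements over that interior form a neighbourhood of \<open>0\<close> contained in \<open>S U\<close>, and this neighbourhood
depends on \<open>N\<close> alone.\<close>

section \<open>Metrization by chains\<close>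

text \<open>The heart of Frink's construction: a function satisfying a triple inequality with factor 2 is at
most twice the length of any chain. A chain is cut at the last point that lies within half of its
length, so that both outer pieces have at most half the total length and the induction hypothesis makes
each of the three pieces at most the total.\<close>
lemma chain_bound:
  fixes f :: "'a \<Rightarrow> 'a \<Rightarrow> real"
  assumes nonneg: "\<And>x y. 0 \<le> f x y"
    and refl: "\<And>x. x \<in> M \<Longrightarrow> f x x = 0"
    and three: "\<And>x y z w e. \<lbrakk>x \<in> M; y \<in> M; z \<in> M; w \<in> M; f x y \<le> e; f y z \<le> e; f z w \<le> e\<rbrakk>
                  \<Longrightarrow> f x w \<le> 2 * e"
    and x: "range x \<subseteq> M"
    and "i \<le> j"
  shows "f (x i) (x j) \<le> 2 * (\<Sum>k=i..<j. f (x k) (x (Suc k)))"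
  using \<open>i \<le> j\<close>
proof (induction "j - i" arbitrary: i j rule: less_induct)
  case less
  define S where "S = (\<lambda>i j. \<Sum>k=i..<j. f (x k) (x (Suc k)))"
  have xM: "x n \<in> M" for n using x by blast
  have S_nonneg: "0 \<le> S m n" for m n by (simp add: S_def sum_nonneg nonneg)
  have IH: "f (x m) (x n) \<le> 2 * S m n" if "n - m < j - i" "m \<le> n" for m n
    using less.hyps that by (simp add: S_def)
  show ?case
  proof (cases "i = j")
    case True
    then show ?thesis by (simp add: refl xM)
  next
    case False
    with less.prems have "i < j" by simp
    \<comment> \<open>The index \<open>j\<close> is excluded from the candidates, so the middle edge exists; \<open>i\<close> is always a candidate.\<close>
    let ?K = "{k. i \<le> k \<and> k < j \<and> S i k \<le> S i j / 2}"
    define k where "k = Max ?K"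
    have fin: "finite ?K" by (rule finite_subset [of _ "{..<j}"]) auto
    have "i \<in> ?K" using \<open>i < j\<close> S_nonneg [of i j] by (simp add: S_def)
    then have k: "k \<in> ?K" unfolding k_def using fin by (intro Max_in) auto
    then have ik: "i \<le> k" "k < j" "S i k \<le> S i j / 2" by auto
    have split1: "S i j = S i (Suc k) + S (Suc k) j"
      unfolding S_def using ik by (subst sum.atLeastLessThan_concat) auto
    have split2: "S i (Suc k) = S i k + f (x k) (x (Suc k))"
      unfolding S_def using ik by simp
    have rest: "S (Suc k) j \<le> S i j / 2"
    proof (cases "Suc k = j")
      case True
      then show ?thesis using S_nonneg [of i j] by (simp add: S_def)
    next
      case False
      have "Suc k \<notin> ?K"
      proof
        assume "Suc k \<in> ?K"
        then have "Suc k \<le> k" unfolding k_def by (rule Max_ge [OF fin])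
        then show False by simp
      qed
      then have "S i (Suc k) > S i j / 2" using False ik by auto
      then show ?thesis using split1 by simp
    qed
    have "f (x i) (x k) \<le> S i j" using IH [of k i] ik by linarith
    moreover have "f (x k) (x (Suc k)) \<le> S i j"
      using split1 split2 S_nonneg [of i k] S_nonneg [of "Suc k" j] by linarith
    moreover have "f (x (Suc k)) (x j) \<le> S i j"
      using IH [of j "Suc k"] ik rest by linarith
    ultimately show ?thesis
      using three [OF xM xM xM xM] by (simp add: S_def)
  qed
qed

text \<open>Chains are infinite sequences in \<open>M\<close> of which only the first \<open>n\<close> steps are measured. This makes
reversal and concatenation plain index shifts.\<close>
definition chain_lengths :: "'a set \<Rightarrow> ('a \<Rightarrow> 'a \<Rightarrow> real) \<Rightarrow> 'a \<Rightarrow> 'a \<Rightarrow> real set" where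
  "chain_lengths M f a b =
     {\<Sum>k<n. f (x k) (x (Suc k)) | n x. range x \<subseteq> M \<and> x 0 = a \<and> x n = b}"

lemma chain_lengthsI:
  "\<lbrakk>range x \<subseteq> M; x 0 = a; x n = b\<rbrakk> \<Longrightarrow> (\<Sum>k<n. f (x k) (x (Suc k))) \<in> chain_lengths M f a b"
  unfolding chain_lengths_def by blast

lemma chain_lengths_edge:
  assumes "a \<in> M" "b \<in> M"
  shows "f a b \<in> chain_lengths M f a b"
  using chain_lengthsI [of "\<lambda>k. if k = 0 then a else b" M a 1 b f] assms by auto

lemma chain_lengths_commute:
  assumes sym: "\<And>x y. \<lbrakk>x \<in> M; y \<in> M\<rbrakk> \<Longrightarrow> f x y = f y x"
  shows "chain_lengths M f a b \<subseteq> chain_lengths M f b a"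
proof
  fix l assume "l \<in> chain_lengths M f a b"
  then obtain n x where x: "range x \<subseteq> M" "x 0 = a" "x n = b"
    and l: "l = (\<Sum>k<n. f (x k) (x (Suc k)))"
    unfolding chain_lengths_def by blast
  let ?y = "\<lambda>k. x (n - k)"
  have "(\<Sum>k<n. f (?y k) (?y (Suc k))) = (\<Sum>k<n. f (x (Suc (n - Suc k))) (x (n - Suc k)))"
    by (intro sum.cong) (auto simp: Suc_diff_Suc)
  also have "\<dots> = (\<Sum>k<n. f (x (Suc k)) (x k))"
    by (rule sum.nat_diff_reindex)
  also have "\<dots> = l"
    unfolding l using x(1) by (intro sum.cong sym) auto
  finally show "l \<in> chain_lengths M f b a"
    using chain_lengthsI [of ?y M b n a f] x by auto
qed

lemma chain_lengths_add:
  assumes "l \<in> chain_lengths M f a b" "m \<in> chain_lengths M f b c"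
  shows "l + m \<in> chain_lengths M f a c"
proof -
  obtain n x where x: "range x \<subseteq> M" "x 0 = a" "x n = b"
    and l: "l = (\<Sum>k<n. f (x k) (x (Suc k)))"
    using assms(1) unfolding chain_lengths_def by blast
  obtain p y where y: "range y \<subseteq> M" "y 0 = b" "y p = c"
    and m: "m = (\<Sum>k<p. f (y k) (y (Suc k)))"
    using assms(2) unfolding chain_lengths_def by blast
  let ?z = "\<lambda>k. if k < n then x k else y (k - n)"
  have "(\<Sum>k<n + p. f (?z k) (?z (Suc k)))
      = (\<Sum>k<n. f (?z k) (?z (Suc k))) + (\<Sum>k<p. f (?z (n + k)) (?z (Suc (n + k))))"
    by (induction p) (auto simp: add.assoc)
  also have "(\<Sum>k<n. f (?z k) (?z (Suc k))) = l"
    unfolding l using x y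
    by (intro sum.cong) (auto simp: not_less less_Suc_eq dest: le_antisym)
  also have "(\<Sum>k<p. f (?z (n + k)) (?z (Suc (n + k)))) = m"
    unfolding m by (intro sum.cong) (auto simp: Suc_diff_le)
  finally have *: "l + m = (\<Sum>k<n + p. f (?z k) (?z (Suc k)))" by simp
  have "?z 0 = a" using x y by (cases n) auto
  moreover have "?z (n + p) = c" using y by simp
  moreover have "range ?z \<subseteq> M" using x y by auto
  ultimately show ?thesis unfolding * by (intro chain_lengthsI)
qed

text \<open>The metric is the infimum of the lengths of chains between two points. The triangle inequality
holds because chains can be concatenated, and \<open>chain_bound\<close> prevents the infimum from dropping below
half of \<open>f\<close>.\<close>
lemma Frink_metric:
  fixes f :: "'a \<Rightarrow> 'a \<Rightarrow> real"
  assumes nonneg: "\<And>x y. 0 \<le> f x y"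
    and eq0: "\<And>x y. \<lbrakk>x \<in> M; y \<in> M\<rbrakk> \<Longrightarrow> f x y = 0 \<longleftrightarrow> x = y"
    and sym: "\<And>x y. f x y = f y x"
    and three: "\<And>x y z w e. \<lbrakk>x \<in> M; y \<in> M; z \<in> M; w \<in> M; f x y \<le> e; f y z \<le> e; f z w \<le> e\<rbrakk>
                  \<Longrightarrow> f x w \<le> 2 * e"
  obtains d where "Metric_space M d"
    and "\<And>x y. \<lbrakk>x \<in> M; y \<in> M\<rbrakk> \<Longrightarrow> f x y \<le> 2 * d x y"
    and "\<And>x y. \<lbrakk>x \<in> M; y \<in> M\<rbrakk> \<Longrightarrow> d x y \<le> f x y"
proof -
  define d where "d = (\<lambda>a b. if a \<in> M \<and> b \<in> M then Inf (chain_lengths M f a b) else 0)"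
  have lower: "f a b \<le> 2 * l" if "l \<in> chain_lengths M f a b" for a b l
  proof -
    obtain n x where x: "range x \<subseteq> M" "x 0 = a" "x n = b"
      and l: "l = (\<Sum>k<n. f (x k) (x (Suc k)))"
      using \<open>l \<in> chain_lengths M f a b\<close> unfolding chain_lengths_def by blast
    show ?thesis
      using chain_bound [where f = f and M = M and x = x and i = 0 and j = n] nonneg three eq0 x
      by (simp add: l lessThan_atLeast0)
  qed
  have bdd: "bdd_below (chain_lengths M f a b)" for a b
  proof (rule bdd_belowI)
    fix l assume "l \<in> chain_lengths M f a b"
    then show "0 \<le> l" using lower nonneg [of a b] by force
  qed
  have le_f: "d a b \<le> f a b" if "a \<in> M" "b \<in> M" for a b
    using that cInf_lower [OF chain_lengths_edge bdd] by (simp add: d_def)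
  have f_le: "f a b \<le> 2 * d a b" if "a \<in> M" "b \<in> M" for a b
  proof -
    have "f a b / 2 \<le> Inf (chain_lengths M f a b)"
      using chain_lengths_edge [OF that, of f] lower by (intro cInf_greatest) force+
    then show ?thesis using that by (simp add: d_def)
  qed
  have "Metric_space M d"
  proof
    fix a b c
    show "0 \<le> d a b"
      using f_le [of a b] nonneg [of a b] by (cases "a \<in> M \<and> b \<in> M") (auto simp: d_def)
    show "d a b = d b a"
      using chain_lengths_commute [of M f a b] chain_lengths_commute [of M f b a] sym
      by (auto simp: d_def)
    show "d a b = 0 \<longleftrightarrow> a = b" if "a \<in> M" "b \<in> M"
      using le_f [of a b] f_le [of a b] eq0 [of a b] nonneg [of a b] \<open>0 \<le> d a b\<close> that by auto
    show "d a c \<le> d a b + d b c" if "a \<in> M" "b \<in> M" "c \<in> M"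
    proof -
      have ne: "chain_lengths M f u v \<noteq> {}" if "u \<in> M" "v \<in> M" for u v
        using chain_lengths_edge [OF that] by blast
      have *: "d a c \<le> l + m" if "l \<in> chain_lengths M f a b" "m \<in> chain_lengths M f b c" for l m
        using cInf_lower [OF chain_lengths_add [OF that] bdd] \<open>a \<in> M\<close> \<open>c \<in> M\<close> by (simp add: d_def)
      have "d a c - l \<le> d b c" if l: "l \<in> chain_lengths M f a b" for l
      proof -
        have "d a c - l \<le> Inf (chain_lengths M f b c)"
          using * [OF l] ne \<open>b \<in> M\<close> \<open>c \<in> M\<close> by (intro cInf_greatest) (auto simp: algebra_simps)
        then show ?thesis using \<open>b \<in> M\<close> \<open>c \<in> M\<close> by (simp add: d_def)
      qed
      then have "d a c - d b c \<le> Inf (chain_lengths M f a b)"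
        using ne \<open>a \<in> M\<close> \<open>b \<in> M\<close> by (intro cInf_greatest) (auto simp: algebra_simps)
      then show ?thesis using \<open>a \<in> M\<close> \<open>b \<in> M\<close> by (simp add: d_def)
    qed
  qed
  then show thesis using that f_le le_f by blast
qed

text \<open>Metrization of a uniformity with a countable base. The relations are encoded by the function that takes
the value \<open>2\<^sup>-\<^sup>n\<close> at a pair whose first failure is at \<open>R n\<close>. The cube condition is then
exactly the triple inequality of \<open>Frink_metric\<close>.\<close>
lemma metrizable_space_entourages:
  fixes X :: "'a topology" and R :: "nat \<Rightarrow> ('a \<times> 'a) set"
  assumes t1: "t1_space X"
    and refl: "\<And>n x. x \<in> topspace X \<Longrightarrow> (x, x) \<in> R n"
    and sym: "\<And>n x y. (x, y) \<in> R n \<Longrightarrow> (y, x) \<in> R n"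
    and cube: "\<And>n x y z w. \<lbrakk>(x, y) \<in> R (Suc n); (y, z) \<in> R (Suc n); (z, w) \<in> R (Suc n)\<rbrakk>
                 \<Longrightarrow> (x, w) \<in> R n"
    and sub: "\<And>n. R n \<subseteq> topspace X \<times> topspace X"
    and open_iff: "\<And>W. openin X W \<longleftrightarrow> W \<subseteq> topspace X \<and> (\<forall>x\<in>W. \<exists>n. R n `` {x} \<subseteq> W)"
  shows "metrizable_space X"
proof -
  let ?M = "topspace X"
  have Suc: "R (Suc n) \<subseteq> R n" for n
  proof
    fix p assume p: "p \<in> R (Suc n)"
    obtain x y where xy: "p = (x, y)" by (cases p)
    then have "x \<in> ?M" "y \<in> ?M" using p sub by blast+
    then show "p \<in> R n" using cube [of x x n x y] refl [of x "Suc n"] p xy by simp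
  qed
  have dec: "R n \<subseteq> R m" if "m \<le> n" for m n
    using that lift_Suc_antimono_le [of R, OF Suc] by simp
  have separated: "x = y" if "x \<in> ?M" "y \<in> ?M" "\<And>n. (x, y) \<in> R n" for x y
  proof (rule ccontr)
    assume "x \<noteq> y"
    have "closedin X {y}" by (rule closedin_t1_singleton [OF t1 that(2)])
    then have "openin X (?M - {y})" by (simp only: closedin_def)
    then have "\<forall>z\<in>?M - {y}. \<exists>n. R n `` {z} \<subseteq> ?M - {y}"
      by (rule open_iff [THEN iffD1, THEN conjunct2])
    then obtain n where "R n `` {x} \<subseteq> ?M - {y}" using \<open>x \<in> ?M\<close> \<open>x \<noteq> y\<close> by auto
    then show False using that(3) [of n] by auto
  qed
  define f :: "'a \<Rightarrow> 'a \<Rightarrow> real"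
    where "f = (\<lambda>x y. if \<forall>n. (x, y) \<in> R n then 0 else (1/2) ^ (LEAST n. (x, y) \<notin> R n))"
  have mem_R: "(x, y) \<in> R n \<longleftrightarrow> f x y < (1/2) ^ n" for x y n
  proof (cases "\<forall>n. (x, y) \<in> R n")
    case True
    then show ?thesis by (simp add: f_def)
  next
    case False
    define l where "l = (LEAST n. (x, y) \<notin> R n)"
    have l: "(x, y) \<notin> R l" unfolding l_def using False by (metis LeastI)
    have "(x, y) \<in> R n \<longleftrightarrow> n < l"
      using l dec [of l n] not_less_Least [of n "\<lambda>n. (x, y) \<notin> R n"] unfolding l_def [symmetric]
      by (meson in_mono not_less)
    also have "\<dots> \<longleftrightarrow> (1/2 :: real) ^ l < (1/2) ^ n"
      by (subst power_strict_decreasing_iff) auto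
    also have "(1/2) ^ l = f x y" using False by (simp only: f_def l_def if_False)
    finally show ?thesis .
  qed
  have f_mem_R: "f x y \<le> (1/2) ^ Suc n" if "(x, y) \<in> R n" for x y n
  proof (cases "\<forall>n. (x, y) \<in> R n")
    case False
    define l where "l = (LEAST n. (x, y) \<notin> R n)"
    have l: "(x, y) \<notin> R l" unfolding l_def using False by (metis LeastI)
    then have "n < l" using dec that by (meson in_mono not_less)
    then have "(1/2 :: real) ^ l \<le> (1/2) ^ Suc n" by (intro power_decreasing) auto
    moreover have "f x y = (1/2) ^ l" using False by (simp only: f_def l_def if_False)
    ultimately show ?thesis by simp
  qed (simp add: f_def)
  have f_le1: "f x y \<le> 1" for x y by (simp add: f_def power_le_one)
  have nonneg: "0 \<le> f x y" for x y by (simp add: f_def)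
  have f_sym: "f x y = f y x" for x y
  proof -
    have "(x, y) \<in> R n \<longleftrightarrow> (y, x) \<in> R n" for n using sym by blast
    then show ?thesis by (simp add: f_def)
  qed
  have eq0: "f x y = 0 \<longleftrightarrow> x = y" if "x \<in> ?M" "y \<in> ?M" for x y
    using separated [OF that] refl [OF that(1)] by (auto simp: f_def split: if_splits)
  have three: "f x w \<le> 2 * e" if e: "f x y \<le> e" "f y z \<le> e" "f z w \<le> e" for x y z w e
  proof (rule ccontr)
    assume "\<not> f x w \<le> 2 * e"
    then have fxw: "2 * e < f x w" by simp
    have "0 \<le> e" using e nonneg [of x y] by linarith
    then have "f x w \<noteq> 0" using fxw by simp
    then have "\<not> (\<forall>n. (x, w) \<in> R n)" unfolding f_def by argo
    define l where "l = (LEAST n. (x, w) \<notin> R n)"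
    have l: "(x, w) \<notin> R l" unfolding l_def using \<open>\<not> (\<forall>n. (x, w) \<in> R n)\<close> by (metis LeastI)
    have "f x w = (1/2) ^ l"
      using \<open>\<not> (\<forall>n. (x, w) \<in> R n)\<close> by (simp only: f_def l_def if_False)
    then have "e < (1/2) ^ Suc l" using fxw by simp
    then have "(x, y) \<in> R (Suc l)" "(y, z) \<in> R (Suc l)" "(z, w) \<in> R (Suc l)"
      using e by (auto simp only: mem_R)
    then show False using l cube by blast
  qed
  obtain d where d: "Metric_space ?M d"
    and f_le: "\<And>x y. \<lbrakk>x \<in> ?M; y \<in> ?M\<rbrakk> \<Longrightarrow> f x y \<le> 2 * d x y"
    and le_f: "\<And>x y. \<lbrakk>x \<in> ?M; y \<in> ?M\<rbrakk> \<Longrightarrow> d x y \<le> f x y"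
  proof (rule Frink_metric [of f ?M, OF nonneg eq0 f_sym])
    show "f x w \<le> 2 * e" if "f x y \<le> e" "f y z \<le> e" "f z w \<le> e" for x y z w e
      by (rule three [OF that])
  qed (assumption | (rule that; assumption))+
  interpret Metric_space ?M d by (rule d)
  have "openin X W \<longleftrightarrow> openin mtopology W" for W
  proof -
    have "(\<exists>n. R n `` {x} \<subseteq> W) \<longleftrightarrow> (\<exists>r>0. mball x r \<subseteq> W)" if "x \<in> ?M" for x
    proof
      assume "\<exists>n. R n `` {x} \<subseteq> W"
      then obtain n where n: "R n `` {x} \<subseteq> W" by blast
      have "mball x ((1/2) ^ Suc n) \<subseteq> R n `` {x}"
        using f_le by (force simp: mem_R)
      then show "\<exists>r>0. mball x r \<subseteq> W"
        using n by (intro exI [of _ "(1/2) ^ Suc n"]) auto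
    next
      assume "\<exists>r>0. mball x r \<subseteq> W"
      then obtain r where r: "r > 0" "mball x r \<subseteq> W" by blast
      obtain n where n: "(1/2) ^ n < r" using real_arch_pow_inv [of r "1/2"] r by auto
      have "R n `` {x} \<subseteq> mball x r"
      proof
        fix y assume "y \<in> R n `` {x}"
        then have xy: "(x, y) \<in> R n" by simp
        then have "y \<in> ?M" using sub by blast
        then show "y \<in> mball x r" using le_f [of x y] xy n that by (auto simp: mem_R)
      qed
      then show "\<exists>n. R n `` {x} \<subseteq> W" using r by blast
    qed
    then show ?thesis unfolding open_iff openin_mtopology by blast
  qed
  then have "X = mtopology" by (simp add: topology_eq)
  then show ?thesis using metrizable_space_mtopology by metis
qed

section \<open>Network conditions and the Baire property\<close>

lemma openin_neighbourhood: "\<lbrakk>openin X W; x \<in> W\<rbrakk> \<Longrightarrow> neighbourhood_of X x W"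
  unfolding neighbourhood_of_def using openin_subset by blast

lemma neighbourhood_subset: "neighbourhood_of X x U \<Longrightarrow> U \<subseteq> topspace X"
  and neighbourhood_mem: "neighbourhood_of X x U \<Longrightarrow> x \<in> U"
  unfolding neighbourhood_of_def by blast+

lemma neighbourhood_mono:
  "\<lbrakk>neighbourhood_of X x U; U \<subseteq> V; V \<subseteq> topspace X\<rbrakk> \<Longrightarrow> neighbourhood_of X x V"
  unfolding neighbourhood_of_def by blast

text \<open>If the members of the Pytkeev family inside \<open>U\<close> failed to cover a neighbourhood of \<open>x\<close>, the
complement of their union would accumulate at \<open>x\<close>, and some member inside \<open>U\<close> would have to meet it.
The point \<open>x\<close> is added to each member because a \<open>cn\<close>-network only uses sets that contain it.\<close>
lemma cn_network_strong_Pytkeev: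
  assumes "strong_Pytkeev_property X" "x \<in> topspace X"
  shows "\<exists>\<N>. countable \<N> \<and> cn_network_at X x \<N>"
proof -
  obtain \<D> where \<D>: "countable \<D>" "\<D> \<subseteq> Pow (topspace X)"
    and P: "\<And>U A. \<lbrakk>neighbourhood_of X x U; A \<subseteq> topspace X; x \<in> X closure_of A - A\<rbrakk>
              \<Longrightarrow> \<exists>D\<in>\<D>. D \<subseteq> U \<and> infinite (D \<inter> A)"
    using assms unfolding strong_Pytkeev_property_def by metis
  let ?\<N> = "insert x ` insert {} \<D>"
  have "cn_network_at X x ?\<N>"
    unfolding cn_network_at_def
  proof (intro conjI allI impI)
    show "?\<N> \<subseteq> Pow (topspace X)" using \<D> assms(2) by auto
    fix U assume U: "neighbourhood_of X x U"
    let ?S = "\<Union>{N \<in> ?\<N>. x \<in> N \<and> N \<subseteq> U}"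
    let ?A = "topspace X - ?S"
    have xU: "x \<in> U" using U by (rule neighbourhood_mem)
    have "{x} \<in> {N \<in> ?\<N>. x \<in> N \<and> N \<subseteq> U}" using xU by auto
    then have xS: "x \<in> ?S" by (rule UnionI) simp
    have "x \<notin> X closure_of ?A"
    proof
      assume "x \<in> X closure_of ?A"
      then obtain D where D: "D \<in> \<D>" "D \<subseteq> U" "infinite (D \<inter> ?A)"
        using P [OF U, of ?A] xS by blast
      have "insert x D \<in> {N \<in> ?\<N>. x \<in> N \<and> N \<subseteq> U}" using D xU by auto
      then have "D \<subseteq> ?S" by blast
      then have "D \<inter> ?A = {}" by blast
      then show False using D(3) by simp
    qed
    then obtain W where W: "openin X W" "x \<in> W" "W \<inter> ?A = {}"
      using assms(2) unfolding in_closure_of by blast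
    then have "W \<subseteq> ?S" using openin_subset [OF W(1)] by blast
    moreover have "?S \<subseteq> topspace X" using neighbourhood_subset [OF U] by blast
    ultimately show "neighbourhood_of X x ?S"
      by (rule neighbourhood_mono [OF openin_neighbourhood [OF W(1,2)]])
  qed
  then show ?thesis using \<D>(1) by (meson countable_image countable_insert)
qed

text \<open>Singletons are compact, so each point of the smaller neighbourhood lies in a network member that
contains \<open>x\<close> and stays inside the larger one.\<close>
lemma cn_network_ck:
  assumes "ck_network_at X x \<N>"
  shows "cn_network_at X x \<N>"
  unfolding cn_network_at_def
proof (intro conjI allI impI)
  show "\<N> \<subseteq> Pow (topspace X)" using assms unfolding ck_network_at_def by blast
  fix V assume V: "neighbourhood_of X x V"
  let ?S = "\<Union>{N \<in> \<N>. x \<in> N \<and> N \<subseteq> V}"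
  obtain U where U: "neighbourhood_of X x U"
    and K: "\<And>K. \<lbrakk>compactin X K; K \<subseteq> U\<rbrakk> \<Longrightarrow>
              \<exists>\<F>. finite \<F> \<and> \<F> \<subseteq> \<N> \<and> x \<in> \<Inter>\<F> \<and> K \<subseteq> \<Union>\<F> \<and> \<Union>\<F> \<subseteq> V"
    using assms V unfolding ck_network_at_def by metis
  have "U \<subseteq> ?S"
  proof
    fix y assume y: "y \<in> U"
    then have "compactin X {y}" using neighbourhood_subset [OF U] by auto
    then obtain \<F> where "\<F> \<subseteq> \<N>" "x \<in> \<Inter>\<F>" "y \<in> \<Union>\<F>" "\<Union>\<F> \<subseteq> V" using K [of "{y}"] y by auto
    then show "y \<in> ?S" by blast
  qed
  moreover have "?S \<subseteq> topspace X" using neighbourhood_subset [OF V] by blast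
  ultimately show "neighbourhood_of X x ?S" by (rule neighbourhood_mono [OF U])
qed

text \<open>The set \<open>D\<^sub>k(\<alpha>)\<close> is determined by the list of the first \<open>k\<close> values of \<open>\<alpha>\<close>.\<close>
lemma countable_prefix_Inter: "countable (range (case_prod (prefix_Inter U)))"
proof -
  have eq: "prefix_Inter U k \<alpha> = prefix_Inter U k (\<lambda>i. if i < k then map \<alpha> [0..<k] ! i else 0)" for k \<alpha>
  proof -
    have "same_prefix k \<alpha> = same_prefix k (\<lambda>i. if i < k then map \<alpha> [0..<k] ! i else 0)"
      unfolding same_prefix_def by auto
    then show ?thesis by (simp only: prefix_Inter_def)
  qed
  have "range (case_prod (prefix_Inter U))
      \<subseteq> (\<lambda>(k, l). prefix_Inter U k (\<lambda>i. if i < k then l ! i else 0)) ` (UNIV :: (nat \<times> nat list) set)"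
    using eq by (force simp del: nth_map map_upt_Suc)
  then show ?thesis by (rule countable_subset) (intro countable_image countableI_type)
qed

text \<open>Condition (D) says that \<open>U\<^sub>\<alpha>\<close> is the union of the sets \<open>D\<^sub>k(\<alpha>)\<close>, all of which contain \<open>x\<close>. Hence
these countably many sets form a network.\<close>
lemma cn_network_omega_base:
  assumes "omega_base_at X x U" "condition_D U"
  shows "\<exists>\<N>. countable \<N> \<and> cn_network_at X x \<N>"
proof -
  let ?\<N> = "range (case_prod (prefix_Inter U)) \<inter> Pow (topspace X)"
  have nb: "neighbourhood_of X x (U \<alpha>)" for \<alpha>
    using assms(1) by (simp add: omega_base_at_def)
  have "cn_network_at X x ?\<N>"
    unfolding cn_network_at_def
  proof (intro conjI allI impI)
    fix V assume V: "neighbourhood_of X x V"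
    let ?S = "\<Union>{N \<in> ?\<N>. x \<in> N \<and> N \<subseteq> V}"
    obtain \<alpha> where \<alpha>: "U \<alpha> \<subseteq> V" using assms(1) V by (auto simp: omega_base_at_def)
    have x: "x \<in> U \<beta>" for \<beta> using nb by (rule neighbourhood_mem)
    have D: "U \<alpha> = (\<Union>k. prefix_Inter U k \<alpha>)" using assms(2) by (simp only: condition_D_def)
    have "U \<alpha> \<subseteq> ?S"
    proof
      fix y assume "y \<in> U \<alpha>"
      then obtain k where k: "y \<in> prefix_Inter U k \<alpha>" using D by blast
      have "x \<in> prefix_Inter U k \<alpha>" unfolding prefix_Inter_def using x by blast
      moreover have sub: "prefix_Inter U k \<alpha> \<subseteq> U \<alpha>" using D by blast
      moreover have "U \<alpha> \<subseteq> topspace X" using nb by (rule neighbourhood_subset)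
      moreover have "prefix_Inter U k \<alpha> \<in> range (case_prod (prefix_Inter U))"
        using rangeI [of "case_prod (prefix_Inter U)" "(k, \<alpha>)"] by simp
      ultimately have "prefix_Inter U k \<alpha> \<in> {N \<in> ?\<N>. x \<in> N \<and> N \<subseteq> V}"
        using \<alpha> by auto
      then show "y \<in> ?S" using k by (rule UnionI)
    qed
    moreover have "?S \<subseteq> topspace X" by blast
    ultimately show "neighbourhood_of X x ?S" by (rule neighbourhood_mono [OF nb])
  qed blast
  then show ?thesis using countable_prefix_Inter by (meson countable_Int1)
qed

lemma metrizable_decreasing_base:
  assumes "metrizable_space X" "x \<in> topspace X"
  obtains B where "\<And>n::nat. openin X (B n)" "\<And>n. x \<in> B n" "decseq B"
    "\<And>U. neighbourhood_of X x U \<Longrightarrow> \<exists>n. B n \<subseteq> U"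
proof -
  obtain M d where "Metric_space M d" and X: "X = Metric_space.mtopology M d"
    using assms(1) unfolding metrizable_space_def by blast
  then interpret Metric_space M d by blast
  have x: "x \<in> M" using assms(2) X by simp
  let ?B = "\<lambda>n. mball x (inverse (real (Suc n)))"
  show thesis
  proof
    show "openin X (?B n)" for n by (simp add: X)
    show "x \<in> ?B n" for n using x by simp
    show "decseq ?B" unfolding decseq_def by (intro allI impI mball_subset_concentric) simp
    fix U assume "neighbourhood_of X x U"
    then obtain W where W: "openin mtopology W" "x \<in> W" "W \<subseteq> U"
      unfolding neighbourhood_of_def X by blast
    then obtain r where r: "r > 0" "mball x r \<subseteq> W" unfolding openin_mtopology by blast
    obtain n where "inverse (real (Suc n)) < r" using reals_Archimedean r(1) by blast
    then have "?B n \<subseteq> mball x r" by (intro mball_subset_concentric) simp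
    then show "\<exists>n. ?B n \<subseteq> U" using r W by blast
  qed
qed

text \<open>In a \<open>T\<^sub>1\<close> space every neighbourhood of an accumulation point of \<open>A\<close> meets \<open>A\<close> in an infinite set,
so a countable base at the point serves as the Pytkeev family.\<close>
lemma metrizable_imp_strong_Pytkeev:
  assumes "metrizable_space X"
  shows "strong_Pytkeev_property X"
  unfolding strong_Pytkeev_property_def
proof
  fix x assume x: "x \<in> topspace X"
  obtain B where B: "\<And>n::nat. openin X (B n)" "\<And>n. x \<in> B n" and "decseq B"
    and base: "\<And>U. neighbourhood_of X x U \<Longrightarrow> \<exists>n. B n \<subseteq> U"
    by (rule metrizable_decreasing_base [OF assms x]) (rule that)
  have t1: "t1_space X" using assms by (rule metrizable_imp_t1_space)
  have "\<exists>D\<in>range B. D \<subseteq> U \<and> infinite (D \<inter> A)"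
    if U: "neighbourhood_of X x U" and A: "A \<subseteq> topspace X" "x \<in> X closure_of A - A" for U A
  proof -
    obtain n where n: "B n \<subseteq> U" using base [OF U] by blast
    have "infinite (B n \<inter> A)"
    proof
      assume "finite (B n \<inter> A)"
      then have "closedin X (B n \<inter> A)" using t1 A(1) t1_space_closedin_finite by blast
      then have opn: "openin X (B n - B n \<inter> A)" using B(1) by (intro openin_diff)
      have x_in: "x \<in> B n - B n \<inter> A" using B(2) A(2) by blast
      have "\<exists>y\<in>A. y \<in> V" if "x \<in> V" "openin X V" for V
        using A(2) that by (auto simp: in_closure_of)
      from this [OF x_in opn] show False by blast
    qed
    then show ?thesis using n by blast
  qed
  moreover have "range B \<subseteq> Pow (topspace X)" using openin_subset [OF B(1)] by blast
  ultimately show "\<exists>\<D>. countable \<D> \<and> \<D> \<subseteq> Pow (topspace X) \<and>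
      (\<forall>U A. neighbourhood_of X x U \<and> A \<subseteq> topspace X \<and> x \<in> X closure_of A - A \<longrightarrow>
         (\<exists>D\<in>\<D>. D \<subseteq> U \<and> infinite (D \<inter> A)))"
    by (intro exI [of _ "range B"]) simp
qed

lemma metrizable_imp_countable_ck_character:
  assumes "metrizable_space X"
  shows "countable_ck_character X"
  unfolding countable_ck_character_def
proof
  fix x assume x: "x \<in> topspace X"
  obtain B where B: "\<And>n::nat. openin X (B n)" "\<And>n. x \<in> B n" and "decseq B"
    and base: "\<And>U. neighbourhood_of X x U \<Longrightarrow> \<exists>n. B n \<subseteq> U"
    by (rule metrizable_decreasing_base [OF assms x]) (rule that)
  have sub: "B n \<subseteq> topspace X" for n using B(1) by (rule openin_subset)
  have "ck_network_at X x (range B)"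
    unfolding ck_network_at_def
  proof (intro conjI allI impI)
    show "range B \<subseteq> Pow (topspace X)" using sub by blast
    fix V assume V: "neighbourhood_of X x V"
    obtain n where n: "B n \<subseteq> V" using base [OF V] by blast
    have "neighbourhood_of X x (B n)" by (rule openin_neighbourhood [OF B(1,2)])
    moreover have "\<exists>\<F>. finite \<F> \<and> \<F> \<subseteq> range B \<and> x \<in> \<Inter>\<F> \<and> K \<subseteq> \<Union>\<F> \<and> \<Union>\<F> \<subseteq> V"
      if "K \<subseteq> B n" for K
      using that n B(2) by (intro exI [of _ "{B n}"]) auto
    ultimately have "neighbourhood_of X x (B n) \<and> (\<forall>K. compactin X K \<and> K \<subseteq> B n \<longrightarrow>
        (\<exists>\<F>. finite \<F> \<and> \<F> \<subseteq> range B \<and> x \<in> \<Inter>\<F> \<and> K \<subseteq> \<Union>\<F> \<and> \<Union>\<F> \<subseteq> V))"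
      by simp
    then show "\<exists>U. neighbourhood_of X x U \<and> (\<forall>K. compactin X K \<and> K \<subseteq> U \<longrightarrow>
        (\<exists>\<F>. finite \<F> \<and> \<F> \<subseteq> range B \<and> x \<in> \<Inter>\<F> \<and> K \<subseteq> \<Union>\<F> \<and> \<Union>\<F> \<subseteq> V))"
      by (rule exI)
  qed
  then show "\<exists>\<N>. countable \<N> \<and> ck_network_at X x \<N>" by (intro exI [of _ "range B"]) simp
qed

text \<open>A decreasing base \<open>B\<close> is indexed by the initial value of \<open>\<alpha>\<close>. Then \<open>D\<^sub>1(\<alpha>)\<close> is already all of
\<open>U\<^sub>\<alpha>\<close>.\<close>
lemma metrizable_imp_has_omega_base_D:
  assumes "metrizable_space X"
  shows "has_omega_base_D X"
  unfolding has_omega_base_D_def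
proof
  fix x assume x: "x \<in> topspace X"
  obtain B where B: "\<And>n::nat. openin X (B n)" "\<And>n. x \<in> B n" and dec: "decseq B"
    and base: "\<And>U. neighbourhood_of X x U \<Longrightarrow> \<exists>n. B n \<subseteq> U"
    by (rule metrizable_decreasing_base [OF assms x]) (rule that)
  define U where "U = (\<lambda>\<alpha> :: nat \<Rightarrow> nat. B (\<alpha> 0))"
  have "omega_base_at X x U"
    unfolding omega_base_at_def
  proof (intro conjI allI impI)
    show "neighbourhood_of X x (U \<alpha>)" for \<alpha>
      unfolding U_def by (rule openin_neighbourhood [OF B(1,2)])
    show "\<exists>\<alpha>. U \<alpha> \<subseteq> V" if V: "neighbourhood_of X x V" for V
    proof -
      obtain n where "B n \<subseteq> V" using base [OF V] by blast
      then show ?thesis by (intro exI [of _ "\<lambda>_. n"]) (simp add: U_def)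
    qed
    show "U \<beta> \<subseteq> U \<alpha>" if "\<alpha> \<le> \<beta>" for \<alpha> \<beta>
      using that dec by (simp add: U_def decseq_def le_fun_def)
  qed
  moreover have "condition_D U"
    unfolding condition_D_def
  proof (intro allI equalityI subsetI)
    fix \<alpha> y
    show "y \<in> (\<Union>k. prefix_Inter U k \<alpha>)" if "y \<in> U \<alpha>"
    proof
      show "y \<in> prefix_Inter U 1 \<alpha>"
        using that by (simp add: prefix_Inter_def same_prefix_def U_def)
    qed simp
    show "y \<in> U \<alpha>" if "y \<in> (\<Union>k. prefix_Inter U k \<alpha>)"
      using that by (auto simp: prefix_Inter_def same_prefix_def)
  qed
  ultimately show "\<exists>U. omega_base_at X x U \<and> condition_D U" by blast
qed

text \<open>A nonempty open subset of a Baire space is not covered by countably many nowhere dense sets: the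
complements of their closures would be dense open sets whose intersection misses it.\<close>
lemma baire_space_interior_closure:
  assumes "baire_space X" "countable \<N>" "openin X W" "W \<noteq> {}" "W \<subseteq> \<Union>\<N>"
    and sub: "\<And>N. N \<in> \<N> \<Longrightarrow> N \<subseteq> topspace X"
  obtains N where "N \<in> \<N>" "X interior_of (X closure_of N) \<noteq> {}"
proof (rule ccontr)
  assume "\<not> thesis"
  with that have empty: "\<And>N. N \<in> \<N> \<Longrightarrow> X interior_of (X closure_of N) = {}" by blast
  let ?\<G> = "(\<lambda>N. topspace X - X closure_of N) ` \<N>"
  have "X closure_of (topspace X - X closure_of N) = topspace X" if "N \<in> \<N>" for N
    using empty [OF that] by (simp add: closure_of_complement)
  then have "\<forall>W\<in>?\<G>. openin X W \<and> X closure_of W = topspace X" by auto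
  then have dense: "X closure_of (topspace X \<inter> \<Inter>?\<G>) = topspace X"
    using assms(1) countable_image [OF assms(2)] unfolding baire_space_def by metis
  obtain y where "y \<in> W" using assms(4) by blast
  moreover have "y \<in> topspace X" using openin_subset [OF assms(3)] \<open>y \<in> W\<close> by blast
  ultimately obtain z where z: "z \<in> W" "z \<in> topspace X \<inter> \<Inter>?\<G>"
    using dense assms(3) in_closure_of [of y X "topspace X \<inter> \<Inter>?\<G>"] by auto
  then obtain N where "N \<in> \<N>" "z \<in> N" using assms(5) by blast
  then show False using z closure_of_subset [OF sub] by blast
qed

section \<open>Gyrogroup identities and sums of invariant sets\<close>

context gyrogroup
begin

abbreviation sum_of_sets (infixl "\<boxplus>" 65) where
  "A \<boxplus> B \<equiv> set_add (\<oplus>) A B"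

abbreviation invariant :: "'a set \<Rightarrow> bool" where
  "invariant A \<equiv> gyr_invariant G gyr A"

lemma gyr_closed: "\<lbrakk>x \<in> G; y \<in> G; z \<in> G\<rbrakk> \<Longrightarrow> gyr x y z \<in> G"
  using gyr_bij bij_betwE by metis

text \<open>Applying \<open>\<ominus>a\<close> to \<open>a \<oplus> b\<close> gives the image of \<open>b\<close> under the injective map \<open>gyr[\<ominus>a, a]\<close>. That this
gyration is the identity is proved from cancellation later (\<open>neg_add_cancel\<close>).\<close>
lemma left_cancel:
  assumes "a \<in> G" "b \<in> G" "c \<in> G" "a \<oplus> b = a \<oplus> c"
  shows "b = c"
proof -
  have *: "neg a \<oplus> (a \<oplus> z) = gyr (neg a) a z" if "z \<in> G" for z
    using that assms(1) by (simp add: left_gyroassoc left_neg left_zero gyr_closed neg_closed)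
  have "gyr (neg a) a b = gyr (neg a) a c"
    using * [OF assms(2)] * [OF assms(3)] assms(4) by simp
  moreover have "inj_on (gyr (neg a) a) G"
    using gyr_bij assms(1) neg_closed bij_betw_imp_inj_on by metis
  ultimately show ?thesis using assms by (simp add: inj_on_eq_iff)
qed

lemma gyr_zero_left:
  assumes "b \<in> G" "z \<in> G"
  shows "gyr zero b z = z"
proof -
  have "b \<oplus> gyr zero b z = zero \<oplus> (b \<oplus> z)"
    using left_gyroassoc [OF zero_closed assms] assms by (simp add: left_zero)
  also have "\<dots> = b \<oplus> z" using assms by (simp add: left_zero add_closed)
  finally show ?thesis using left_cancel assms gyr_closed zero_closed by blast
qed

text \<open>The loop law reduces \<open>gyr[\<ominus>b, b]\<close> to \<open>gyr[0, b]\<close>, which is the identity.\<close>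
lemma neg_add_cancel:
  assumes "b \<in> G" "z \<in> G"
  shows "neg b \<oplus> (b \<oplus> z) = z"
proof -
  have "gyr (neg b) b z = gyr (neg b \<oplus> b) b z"
    using assms by (simp add: left_loop neg_closed)
  also have "\<dots> = z" using assms by (simp add: left_neg gyr_zero_left)
  finally show ?thesis
    using assms by (simp add: left_gyroassoc left_neg left_zero neg_closed)
qed

lemma neg_neg: "b \<in> G \<Longrightarrow> neg (neg b) = b"
  using left_cancel [of "neg b" "neg (neg b)" b] by (simp add: neg_closed left_neg right_neg)

lemma add_neg_cancel: "\<lbrakk>b \<in> G; z \<in> G\<rbrakk> \<Longrightarrow> b \<oplus> (neg b \<oplus> z) = z"
  using neg_add_cancel [of "neg b" z] by (simp add: neg_closed neg_neg)

lemma neg_unique: "\<lbrakk>a \<in> G; b \<in> G; a \<oplus> b = zero\<rbrakk> \<Longrightarrow> b = neg a"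
  using left_cancel [of a b "neg a"] by (simp add: neg_closed right_neg)

lemma gyr_zero:
  assumes "x \<in> G" "y \<in> G"
  shows "gyr x y zero = zero"
proof -
  have "gyr x y zero \<oplus> gyr x y zero = gyr x y zero \<oplus> zero"
    using gyr_hom [OF assms zero_closed zero_closed] assms
    by (simp add: left_zero right_zero zero_closed gyr_closed)
  then show ?thesis using left_cancel assms gyr_closed zero_closed by blast
qed

lemma gyr_neg:
  assumes "x \<in> G" "y \<in> G" "a \<in> G"
  shows "gyr x y (neg a) = neg (gyr x y a)"
proof (rule neg_unique)
  show "gyr x y a \<oplus> gyr x y (neg a) = zero"
    using assms by (simp flip: gyr_hom add: neg_closed right_neg gyr_zero)
qed (use assms in \<open>simp_all add: gyr_closed neg_closed\<close>)

lemma neg_add: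
  assumes "x \<in> G" "y \<in> G"
  shows "neg (x \<oplus> y) = gyr x y (neg y \<oplus> neg x)"
proof -
  have "(x \<oplus> y) \<oplus> gyr x y (neg y \<oplus> neg x) = x \<oplus> (y \<oplus> (neg y \<oplus> neg x))"
    using assms by (simp flip: left_gyroassoc add: neg_closed add_closed)
  also have "\<dots> = zero" using assms by (simp add: add_neg_cancel neg_closed right_neg)
  finally show ?thesis
    using neg_unique assms by (metis add_closed gyr_closed neg_closed)
qed

text \<open>The gyrogroup form of \<open>a\<inverse>c = (a\<inverse>b)(b\<inverse>c)\<close>. For invariant sets the gyration is invisible, and the
differences compose as in a group (\<open>difference_trans\<close>).\<close>
lemma neg_add_trans:
  assumes "a \<in> G" "b \<in> G" "c \<in> G"
  shows "neg a \<oplus> c = (neg a \<oplus> b) \<oplus> gyr (neg a) b (neg b \<oplus> c)"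
  using left_gyroassoc [of "neg a" b "neg b \<oplus> c"] assms
  by (simp add: add_neg_cancel neg_closed add_closed)

lemma invariant_subset: "invariant A \<Longrightarrow> A \<subseteq> G"
  by (simp add: gyr_invariant_def)

lemma invariant_mem_iff:
  assumes "invariant A" "x \<in> G" "y \<in> G" "z \<in> G"
  shows "gyr x y z \<in> A \<longleftrightarrow> z \<in> A"
proof
  have inj: "inj_on (gyr x y) G" using gyr_bij assms bij_betw_imp_inj_on by blast
  have img: "gyr x y ` A = A" using assms by (simp add: gyr_invariant_def)
  show "z \<in> A \<Longrightarrow> gyr x y z \<in> A" using img by blast
  assume "gyr x y z \<in> A"
  then obtain w where "w \<in> A" "gyr x y z = gyr x y w" using img by (metis imageE)
  then show "z \<in> A" using inj assms invariant_subset by (metis inj_onD subsetD)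
qed

lemma invariant_preimage:
  assumes "invariant A" "x \<in> G" "y \<in> G" "z \<in> A"
  obtains w where "w \<in> A" "z = gyr x y w"
  using assms unfolding gyr_invariant_def by (metis imageE)

lemma invariantI:
  assumes "A \<subseteq> G" "\<And>x y z. \<lbrakk>x \<in> G; y \<in> G; z \<in> G\<rbrakk> \<Longrightarrow> gyr x y z \<in> A \<longleftrightarrow> z \<in> A"
  shows "invariant A"
  unfolding gyr_invariant_def
proof (intro conjI ballI equalityI subsetI)
  fix x y z assume xy: "x \<in> G" "y \<in> G"
  show "z \<in> A" if "z \<in> gyr x y ` A" using that assms xy by blast
  show "z \<in> gyr x y ` A" if "z \<in> A"
  proof -
    have "z \<in> gyr x y ` G" using that assms gyr_bij [OF xy] by (auto simp: bij_betw_def)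
    then show ?thesis using that assms xy by blast
  qed
qed (use assms in blast)

lemma sum_of_setsI: "\<lbrakk>a \<in> A; b \<in> B\<rbrakk> \<Longrightarrow> a \<oplus> b \<in> A \<boxplus> B"
  unfolding set_add_def by blast

lemma sum_of_setsE:
  assumes "c \<in> A \<boxplus> B" obtains a b where "c = a \<oplus> b" "a \<in> A" "b \<in> B"
  using assms unfolding set_add_def by blast

lemma sum_of_sets_mono: "\<lbrakk>A \<subseteq> A'; B \<subseteq> B'\<rbrakk> \<Longrightarrow> A \<boxplus> B \<subseteq> A' \<boxplus> B'"
  unfolding set_add_def by blast

lemma sum_of_sets_subset: "\<lbrakk>A \<subseteq> G; B \<subseteq> G\<rbrakk> \<Longrightarrow> A \<boxplus> B \<subseteq> G"
  unfolding set_add_def using add_closed by blast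

text \<open>The gyration in the gyroassociative law acts on the third summand alone, so invariance of the
third set is enough to absorb it.\<close>
lemma sum_of_sets_assoc:
  assumes "A \<subseteq> G" "B \<subseteq> G" "invariant C"
  shows "(A \<boxplus> B) \<boxplus> C = A \<boxplus> (B \<boxplus> C)"
proof (intro equalityI subsetI)
  fix z assume "z \<in> (A \<boxplus> B) \<boxplus> C"
  then obtain a b c where z: "z = (a \<oplus> b) \<oplus> c" "a \<in> A" "b \<in> B" "c \<in> C"
    by (metis sum_of_setsE)
  then have "a \<in> G" "b \<in> G" using assms by auto
  then obtain c' where "c' \<in> C" "c = gyr a b c'"
    using invariant_preimage [OF assms(3) _ _ z(4)] by metis
  then have "z = a \<oplus> (b \<oplus> c')"
    using z \<open>a \<in> G\<close> \<open>b \<in> G\<close> invariant_subset [OF assms(3)] by (simp add: left_gyroassoc subset_iff)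
  then show "z \<in> A \<boxplus> (B \<boxplus> C)" using z \<open>c' \<in> C\<close> by (simp add: sum_of_setsI)
next
  fix z assume "z \<in> A \<boxplus> (B \<boxplus> C)"
  then obtain a b c where z: "z = a \<oplus> (b \<oplus> c)" "a \<in> A" "b \<in> B" "c \<in> C"
    by (metis sum_of_setsE)
  then have G: "a \<in> G" "b \<in> G" "c \<in> G" using assms invariant_subset by auto
  then have "z = (a \<oplus> b) \<oplus> gyr a b c" using z left_gyroassoc by simp
  moreover have "gyr a b c \<in> C" using invariant_mem_iff [OF assms(3) G] z by simp
  ultimately show "z \<in> (A \<boxplus> B) \<boxplus> C" using z by (simp add: sum_of_setsI)
qed

lemma invariant_sum_of_sets:
  assumes A: "invariant A" and B: "invariant B"
  shows "invariant (A \<boxplus> B)"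
  unfolding gyr_invariant_def
proof (intro conjI ballI equalityI subsetI)
  show "x \<in> G" if "x \<in> A \<boxplus> B" for x
    using that sum_of_sets_subset [of A B] A B invariant_subset by blast
next
  fix x y z assume xy: "x \<in> G" "y \<in> G" and "z \<in> gyr x y ` (A \<boxplus> B)"
  then obtain a b where ab: "z = gyr x y (a \<oplus> b)" "a \<in> A" "b \<in> B" by (auto elim: sum_of_setsE)
  moreover have G: "a \<in> G" "b \<in> G" using ab A B invariant_subset by auto
  ultimately have "z = gyr x y a \<oplus> gyr x y b" using xy by (simp add: gyr_hom)
  then show "z \<in> A \<boxplus> B"
    using ab G xy A B by (simp add: sum_of_setsI invariant_mem_iff)
next
  fix x y z assume xy: "x \<in> G" "y \<in> G" and "z \<in> A \<boxplus> B"
  then obtain a b where ab: "z = a \<oplus> b" "a \<in> A" "b \<in> B" by (auto elim: sum_of_setsE)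
  obtain a' where a': "a' \<in> A" "a = gyr x y a'" using invariant_preimage A xy ab by metis
  obtain b' where b': "b' \<in> B" "b = gyr x y b'" using invariant_preimage B xy ab by metis
  have "a' \<in> G" "b' \<in> G" using a' b' A B invariant_subset by auto
  then have "z = gyr x y (a' \<oplus> b')" using ab a' b' xy by (simp add: gyr_hom)
  then show "z \<in> gyr x y ` (A \<boxplus> B)" using a' b' sum_of_setsI by blast
qed

lemma neg_sum_of_sets:
  assumes A: "invariant A" and B: "invariant B"
    and sym: "\<And>a. a \<in> A \<Longrightarrow> neg a \<in> A'" "\<And>b. b \<in> B \<Longrightarrow> neg b \<in> B'"
    and A': "invariant A'" and B': "invariant B'"
    and "c \<in> A \<boxplus> B"
  shows "neg c \<in> B' \<boxplus> A'"
proof -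
  obtain a b where ab: "c = a \<oplus> b" "a \<in> A" "b \<in> B" using assms(7) by (auto elim: sum_of_setsE)
  then have G: "a \<in> G" "b \<in> G" using A B invariant_subset by auto
  then have "neg c = gyr a b (neg b \<oplus> neg a)" using ab neg_add by simp
  moreover have "neg b \<oplus> neg a \<in> B' \<boxplus> A'" using ab sym by (simp add: sum_of_setsI)
  ultimately show ?thesis
    using invariant_mem_iff [OF invariant_sum_of_sets [OF B' A'] G] G by (simp add: add_closed neg_closed)
qed

text \<open>Together with \<open>difference_commute\<close> this makes the relations \<open>\<ominus>a \<oplus> b \<in> A\<close>, for invariant \<open>A\<close>, behave
like the entourages of the left uniformity of a group.\<close>
lemma difference_trans:
  assumes "a \<in> G" "b \<in> G" "c \<in> G" "neg a \<oplus> b \<in> A" "neg b \<oplus> c \<in> B" "invariant B"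
  shows "neg a \<oplus> c \<in> A \<boxplus> B"
  using assms neg_add_trans [of a b c]
  by (simp add: sum_of_setsI invariant_mem_iff neg_closed add_closed)

lemma difference_commute:
  assumes "a \<in> G" "b \<in> G" "neg a \<oplus> b \<in> A" "invariant A" "\<And>x. x \<in> A \<Longrightarrow> neg x \<in> A"
  shows "neg b \<oplus> a \<in> A"
proof -
  have "neg (neg a \<oplus> b) = gyr (neg a) b (neg b \<oplus> a)"
    using assms by (simp add: neg_add neg_neg neg_closed)
  moreover have "neg (neg a \<oplus> b) \<in> A" using assms by blast
  ultimately show ?thesis using assms by (simp add: invariant_mem_iff neg_closed add_closed)
qed

end

section \<open>Saturated neighbourhoods of a neutral subgyrogroup\<close>

locale neutral_coset_space = strongly_topological_gyrogroup T add zero neg gyr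
  for T :: "'a topology"
    and add :: "'a \<Rightarrow> 'a \<Rightarrow> 'a" (infixl "\<oplus>" 65)
    and zero neg gyr +
  fixes H :: "'a set"
  assumes strong: "strong_subgyrogroup (topspace T) (\<oplus>) neg gyr H"
    and neutral: "neutral_in T (\<oplus>) zero H"
begin

abbreviation "G \<equiv> topspace T"
abbreviation "X \<equiv> coset_space T (\<oplus>) H"
abbreviation "\<pi> \<equiv> left_coset (\<oplus>) H"

definition symmetric_nbhd :: "'a set \<Rightarrow> bool" where
  "symmetric_nbhd U \<longleftrightarrow>
     neighbourhood_of T zero U \<and> invariant U \<and> (\<forall>x\<in>U. neg x \<in> U)"

text \<open>For invariant \<open>U\<close> this is the smallest set that contains \<open>U\<close> and absorbs \<open>H\<close> on both sides. The
two-sided absorption makes the relation \<open>\<ominus>a \<oplus> b \<in> saturation U\<close> depend only on the cosets of \<open>a\<close>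
and \<open>b\<close>, and it lets the saturation inherit symmetry from \<open>U\<close>, which \<open>U \<oplus> H\<close> need not do.\<close>
definition saturation :: "'a set \<Rightarrow> 'a set" where
  "saturation U = H \<boxplus> (U \<boxplus> H)"

lemma H_subset: "H \<subseteq> G"
  and H_add: "\<lbrakk>x \<in> H; y \<in> H\<rbrakk> \<Longrightarrow> x \<oplus> y \<in> H"
  and H_neg: "x \<in> H \<Longrightarrow> neg x \<in> H"
  and H_invariant: "invariant H"
  using strong unfolding strong_subgyrogroup_def subgyrogroup_def by auto

lemma H_zero: "zero \<in> H"
proof -
  obtain h where h: "h \<in> H"
    using strong unfolding strong_subgyrogroup_def subgyrogroup_def by blast
  then have "neg h \<oplus> h \<in> H" by (simp add: H_add H_neg)
  then show ?thesis using h H_subset left_neg by auto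
qed

lemma H_idem: "H \<boxplus> H = H"
proof
  show "H \<boxplus> H \<subseteq> H" using H_add by (auto elim: sum_of_setsE)
  show "H \<subseteq> H \<boxplus> H"
  proof
    fix h assume h: "h \<in> H"
    then have "h = zero \<oplus> h" using H_subset left_zero by auto
    then show "h \<in> H \<boxplus> H" using h H_zero sum_of_setsI by metis
  qed
qed

lemma continuous_left_translation:
  assumes "a \<in> G"
  shows "continuous_map T T (\<lambda>x. a \<oplus> x)"
proof -
  have "continuous_map T (prod_topology T T) (\<lambda>x. (a, x))"
    using assms by (simp add: continuous_map_pairedI)
  from continuous_map_compose [OF this continuous_add] show ?thesis by (simp add: o_def)
qed

lemma neighbourhood_translate:
  assumes "openin T W" "a \<in> W"
  obtains U where "neighbourhood_of T zero U" "\<And>u. u \<in> U \<Longrightarrow> a \<oplus> u \<in> W"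
proof
  have a: "a \<in> G" using assms openin_subset by blast
  let ?U = "{x \<in> G. a \<oplus> x \<in> W}"
  have "openin T ?U"
    using continuous_left_translation [OF a] assms(1) by (simp add: openin_continuous_map_preimage)
  then show "neighbourhood_of T zero ?U"
    by (rule openin_neighbourhood) (use assms a zero_closed right_zero in auto)
qed auto

lemma neighbourhood_halve:
  assumes "neighbourhood_of T zero U"
  obtains W where "neighbourhood_of T zero W" "W \<boxplus> W \<subseteq> U"
proof -
  obtain W where W: "openin T W" "zero \<in> W" "W \<subseteq> U"
    using assms unfolding neighbourhood_of_def by blast
  let ?P = "{p \<in> topspace (prod_topology T T). (\<lambda>(x, y). x \<oplus> y) p \<in> W}"
  have P: "openin (prod_topology T T) ?P"
    using continuous_add W(1) by (rule openin_continuous_map_preimage)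
  have "(zero, zero) \<in> ?P" using W zero_closed left_zero by simp
  from openin_prod_topology_alt [THEN iffD1, OF P, rule_format, OF this]
  obtain A B where AB: "openin T A" "openin T B" "zero \<in> A" "zero \<in> B" "A \<times> B \<subseteq> ?P"
    by (elim exE conjE)
  show thesis
  proof
    show "neighbourhood_of T zero (A \<inter> B)"
      using AB by (intro openin_neighbourhood) auto
    show "(A \<inter> B) \<boxplus> (A \<inter> B) \<subseteq> U"
    proof
      fix z assume "z \<in> (A \<inter> B) \<boxplus> (A \<inter> B)"
      then obtain a b where z: "z = a \<oplus> b" "a \<in> A" "b \<in> B" by (auto elim: sum_of_setsE)
      then have "(a, b) \<in> ?P" using AB by blast
      then show "z \<in> U" using z W by auto
    qed
  qed
qed

lemma neighbourhood_Int:
  assumes "neighbourhood_of T zero U" "neighbourhood_of T zero V"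
  shows "neighbourhood_of T zero (U \<inter> V)"
proof -
  obtain A B where "openin T A" "zero \<in> A" "A \<subseteq> U" "openin T B" "zero \<in> B" "B \<subseteq> V"
    using assms unfolding neighbourhood_of_def by blast
  then have "openin T (A \<inter> B)" "zero \<in> A \<inter> B" "A \<inter> B \<subseteq> U \<inter> V" by auto
  moreover have "U \<inter> V \<subseteq> topspace T" using assms unfolding neighbourhood_of_def by blast
  ultimately show ?thesis unfolding neighbourhood_of_def by blast
qed

lemma symmetric_nbhd_exists:
  assumes "neighbourhood_of T zero U"
  obtains V where "symmetric_nbhd V" "V \<subseteq> U"
proof -
  obtain W where W: "neighbourhood_of T zero W" "invariant W" "W \<subseteq> U"
    using gyr_invariant_neighbourhood [OF assms] by blast
  obtain O1 where O1: "openin T O1" "zero \<in> O1" "O1 \<subseteq> W"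
    using W(1) unfolding neighbourhood_of_def by blast
  let ?N = "{x \<in> G. neg x \<in> W}"
  have "openin T {x \<in> G. neg x \<in> O1}"
    using continuous_neg O1(1) by (rule openin_continuous_map_preimage)
  moreover have "neg zero = zero" using left_cancel zero_closed neg_closed left_zero right_neg by metis
  ultimately have "neighbourhood_of T zero ?N"
    unfolding neighbourhood_of_def using O1 zero_closed
    by (intro conjI exI [of _ "{x \<in> G. neg x \<in> O1}"]) auto
  then have nb: "neighbourhood_of T zero (W \<inter> ?N)" using W(1) neighbourhood_Int by blast
  have "invariant (W \<inter> ?N)"
  proof (rule invariantI)
    show "W \<inter> ?N \<subseteq> G" by blast
    fix x y z assume "x \<in> G" "y \<in> G" "z \<in> G"
    then show "gyr x y z \<in> W \<inter> ?N \<longleftrightarrow> z \<in> W \<inter> ?N"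
      using W(2) by (simp add: invariant_mem_iff gyr_closed neg_closed flip: gyr_neg)
  qed
  then have "symmetric_nbhd (W \<inter> ?N)"
    unfolding symmetric_nbhd_def using nb by (auto simp: neg_closed neg_neg)
  then show thesis using that W(3) by blast
qed

lemma symmetric_nbhd_zero: "symmetric_nbhd U \<Longrightarrow> zero \<in> U"
  and symmetric_nbhd_neighbourhood: "symmetric_nbhd U \<Longrightarrow> neighbourhood_of T zero U"
  and symmetric_nbhd_invariant: "symmetric_nbhd U \<Longrightarrow> invariant U"
  and symmetric_nbhd_subset: "symmetric_nbhd U \<Longrightarrow> U \<subseteq> G"
  unfolding symmetric_nbhd_def neighbourhood_of_def by blast+

lemma saturation_mono: "U \<subseteq> V \<Longrightarrow> saturation U \<subseteq> saturation V"
  unfolding saturation_def by (simp add: sum_of_sets_mono)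

lemma saturation_invariant: "invariant U \<Longrightarrow> invariant (saturation U)"
  unfolding saturation_def by (simp add: invariant_sum_of_sets H_invariant)

lemma subset_saturation:
  assumes "U \<subseteq> G"
  shows "U \<subseteq> saturation U"
proof
  fix u assume u: "u \<in> U"
  then have "u = zero \<oplus> (u \<oplus> zero)" using assms by (simp add: left_zero right_zero subset_iff)
  also have "\<dots> \<in> saturation U"
    unfolding saturation_def using u H_zero by (intro sum_of_setsI)
  finally show "u \<in> saturation U" .
qed

lemma saturation_absorbs_left:
  assumes "invariant U"
  shows "H \<boxplus> saturation U = saturation U"
proof -
  have "H \<boxplus> (H \<boxplus> (U \<boxplus> H)) = (H \<boxplus> H) \<boxplus> (U \<boxplus> H)"
    by (rule sum_of_sets_assoc [symmetric])
      (simp_all add: assms H_subset H_invariant invariant_sum_of_sets)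
  then show ?thesis by (simp add: saturation_def H_idem)
qed

lemma saturation_absorbs_right:
  assumes "invariant U"
  shows "saturation U \<boxplus> H = saturation U"
proof -
  have U: "U \<subseteq> G" using assms by (rule invariant_subset)
  have "(H \<boxplus> (U \<boxplus> H)) \<boxplus> H = H \<boxplus> ((U \<boxplus> H) \<boxplus> H)"
    by (rule sum_of_sets_assoc) (simp_all add: U H_subset H_invariant sum_of_sets_subset)
  also have "(U \<boxplus> H) \<boxplus> H = U \<boxplus> (H \<boxplus> H)"
    by (rule sum_of_sets_assoc) (simp_all add: U H_subset H_invariant)
  finally show ?thesis by (simp add: saturation_def H_idem)
qed

lemma saturation_symmetric:
  assumes "symmetric_nbhd U" "x \<in> saturation U"
  shows "neg x \<in> saturation U"
proof -
  have U: "invariant U" using assms(1) by (rule symmetric_nbhd_invariant)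
  have UH: "neg y \<in> H \<boxplus> U" if "y \<in> U \<boxplus> H" for y
    using assms(1) H_neg that unfolding symmetric_nbhd_def
    by (intro neg_sum_of_sets [of U H U H]) (auto simp: H_invariant)
  have "neg x \<in> (H \<boxplus> U) \<boxplus> H"
    using assms(2) H_neg UH U unfolding saturation_def
    by (intro neg_sum_of_sets [of H "U \<boxplus> H" H "H \<boxplus> U"]) (auto simp: H_invariant invariant_sum_of_sets)
  also have "(H \<boxplus> U) \<boxplus> H = saturation U"
    unfolding saturation_def
    by (rule sum_of_sets_assoc) (simp_all add: U invariant_subset H_invariant)
  finally show ?thesis .
qed

text \<open>Neutrality replaces \<open>H \<oplus> V\<close> by a subset of \<open>U \<oplus> H\<close>, and the two copies of \<open>H\<close> on the right merge.\<close>
lemma saturation_small: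
  assumes "neighbourhood_of T zero U"
  obtains V where "symmetric_nbhd V" "saturation V \<subseteq> U \<boxplus> H"
proof -
  obtain V0 where V0: "openin T V0" "zero \<in> V0" "H \<boxplus> V0 \<subseteq> U \<boxplus> H"
    using neutral assms unfolding neutral_in_def by blast
  then have "neighbourhood_of T zero V0" by (intro openin_neighbourhood)
  then obtain V where V: "symmetric_nbhd V" "V \<subseteq> V0" using symmetric_nbhd_exists by blast
  have VG: "V \<subseteq> G" using V(1) by (rule symmetric_nbhd_subset)
  have UG: "U \<subseteq> G" using assms unfolding neighbourhood_of_def by blast
  have "saturation V = (H \<boxplus> V) \<boxplus> H"
    unfolding saturation_def by (rule sum_of_sets_assoc [symmetric]) (simp_all add: VG H_subset H_invariant)
  also have "\<dots> \<subseteq> (U \<boxplus> H) \<boxplus> H" using V0 V by (meson sum_of_sets_mono order_refl order_trans)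
  also have "\<dots> = U \<boxplus> (H \<boxplus> H)"
    by (rule sum_of_sets_assoc) (simp_all add: UG H_subset H_invariant)
  finally show thesis using that V H_idem by simp
qed

text \<open>With \<open>V\<close> inside \<open>W\<close> and \<open>saturation V \<subseteq> W \<oplus> H\<close>, the sum \<open>H V H H V H = H V (H V H)\<close> lies in
\<open>H W (W H)\<close>, which is contained in \<open>H U H\<close> when \<open>W \<oplus> W \<subseteq> U\<close>.\<close>
lemma saturation_halve:
  assumes "symmetric_nbhd U"
  obtains V where "symmetric_nbhd V" "saturation V \<boxplus> saturation V \<subseteq> saturation U"
proof -
  obtain W where W: "neighbourhood_of T zero W" "W \<boxplus> W \<subseteq> U"
    using assms neighbourhood_halve unfolding symmetric_nbhd_def by blast
  obtain V1 where V1: "symmetric_nbhd V1" "saturation V1 \<subseteq> W \<boxplus> H"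
    using W saturation_small by blast
  have "neighbourhood_of T zero (V1 \<inter> W)"
    using V1 W neighbourhood_Int unfolding symmetric_nbhd_def by blast
  then obtain V where V: "symmetric_nbhd V" "V \<subseteq> V1 \<inter> W" using symmetric_nbhd_exists by blast
  have inv: "invariant V" "invariant (saturation V)"
    using V symmetric_nbhd_invariant saturation_invariant by auto
  have sub: "V \<subseteq> G" "W \<subseteq> G" "saturation V \<subseteq> G"
    using inv W invariant_subset unfolding neighbourhood_of_def by auto
  have "saturation V \<boxplus> saturation V = H \<boxplus> ((V \<boxplus> H) \<boxplus> saturation V)"
    \<comment> \<open>Only the left summand is unfolded.\<close>
    unfolding saturation_def [of V, THEN arg_cong, of "\<lambda>S. S \<boxplus> saturation V"]
    by (rule sum_of_sets_assoc) (simp_all add: sub inv H_subset sum_of_sets_subset)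
  also have "(V \<boxplus> H) \<boxplus> saturation V = V \<boxplus> (H \<boxplus> saturation V)"
    by (rule sum_of_sets_assoc) (simp_all add: sub inv H_subset)
  also have "H \<boxplus> saturation V = saturation V"
    using inv by (simp add: saturation_absorbs_left)
  also have "H \<boxplus> (V \<boxplus> saturation V) \<subseteq> H \<boxplus> (W \<boxplus> (W \<boxplus> H))"
    using V V1 saturation_mono [of V V1] by (intro sum_of_sets_mono) auto
  also have "W \<boxplus> (W \<boxplus> H) = (W \<boxplus> W) \<boxplus> H"
    by (rule sum_of_sets_assoc [symmetric]) (simp_all add: sub H_invariant)
  also have "H \<boxplus> ((W \<boxplus> W) \<boxplus> H) \<subseteq> saturation U"
    unfolding saturation_def using W by (intro sum_of_sets_mono) auto
  finally show thesis using that V by blast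
qed

section \<open>The left uniformity of the coset space\<close>

lemma coset_eq_singleton: "\<pi> a = {a} \<boxplus> H"
  unfolding left_coset_def set_add_def by blast

lemma coset_eq_iff:
  assumes "a \<in> G" "b \<in> G"
  shows "\<pi> a = \<pi> b \<longleftrightarrow> neg a \<oplus> b \<in> H"
proof
  assume "\<pi> a = \<pi> b"
  moreover have "b \<in> \<pi> b"
    unfolding left_coset_def using H_zero assms by (force simp: right_zero)
  ultimately obtain h where h: "h \<in> H" "b = a \<oplus> h" unfolding left_coset_def by blast
  then show "neg a \<oplus> b \<in> H" using neg_add_cancel assms H_subset by (metis subsetD)
next
  assume h: "neg a \<oplus> b \<in> H"
  define h where "h = neg a \<oplus> b"
  have hH: "h \<in> H" and hG: "h \<in> G" using \<open>neg a \<oplus> b \<in> H\<close> H_subset by (auto simp: h_def)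
  have b: "b = a \<oplus> h" using assms by (simp add: h_def add_neg_cancel)
  have "{h} \<boxplus> H = H"
  proof (intro equalityI subsetI)
    show "z \<in> H" if "z \<in> {h} \<boxplus> H" for z using that hH H_add by (auto elim: sum_of_setsE)
    show "z \<in> {h} \<boxplus> H" if "z \<in> H" for z
    proof -
      have "z = h \<oplus> (neg h \<oplus> z)" using that hG H_subset by (simp add: add_neg_cancel subset_iff)
      then show ?thesis using that hH H_add H_neg sum_of_setsI by (metis singletonI)
    qed
  qed
  moreover have "{b} = {a} \<boxplus> {h}" using b by (auto simp: set_add_def)
  then have "\<pi> b = {a} \<boxplus> ({h} \<boxplus> H)"
    using assms hG by (simp add: coset_eq_singleton sum_of_sets_assoc H_invariant)
  ultimately show "\<pi> a = \<pi> b" by (simp add: coset_eq_singleton)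
qed

lemma topspace_coset_space: "topspace X = \<pi> ` G"
  by (simp add: coset_space_def)

lemma openin_coset_space:
  "openin X W \<longleftrightarrow> W \<subseteq> \<pi> ` G \<and> openin T {a \<in> G. \<pi> a \<in> W}"
  by (simp add: coset_space_def openin_quotient_topology)

lemma saturation_trans:
  assumes "a \<in> G" "b \<in> G" "c \<in> G" "invariant U" "invariant V"
    and "neg a \<oplus> b \<in> saturation U" "neg b \<oplus> c \<in> saturation V"
  shows "neg a \<oplus> c \<in> saturation U \<boxplus> saturation V"
  using assms by (intro difference_trans [of a b c]) (auto simp: saturation_invariant)

lemma saturation_cong:
  assumes G: "a \<in> G" "a' \<in> G" "b \<in> G" "b' \<in> G" and inv: "invariant U"
    and "\<pi> a = \<pi> a'" "\<pi> b = \<pi> b'" and ab: "neg a \<oplus> b \<in> saturation U"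
  shows "neg a' \<oplus> b' \<in> saturation U"
proof -
  have "neg a' \<oplus> a \<in> H" using coset_eq_iff [OF G(2,1)] assms(6) by simp
  then have "neg a' \<oplus> b \<in> H \<boxplus> saturation U"
    by (rule difference_trans [OF G(2,1,3) _ ab saturation_invariant [OF inv]])
  then have "neg a' \<oplus> b \<in> saturation U" by (simp add: saturation_absorbs_left inv)
  moreover have "neg b \<oplus> b' \<in> H" using coset_eq_iff [OF G(3,4)] assms(7) by simp
  ultimately have "neg a' \<oplus> b' \<in> saturation U \<boxplus> H"
    using difference_trans [OF G(2,3,4)] H_invariant by blast
  then show ?thesis by (simp add: saturation_absorbs_right inv)
qed

lemma zero_saturation: "symmetric_nbhd U \<Longrightarrow> zero \<in> saturation U"
  using subset_saturation symmetric_nbhd_subset symmetric_nbhd_zero by blast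

text \<open>The quotient topology is the topology of the uniformity given by the saturations. For an open set,
a neighbourhood \<open>a \<oplus> U\<^sub>0\<close> of \<open>a\<close> inside the preimage can be enlarged to \<open>a \<oplus> (U\<^sub>0 \<oplus> H)\<close>, since
\<open>a \<oplus> (u \<oplus> h)\<close> and \<open>a \<oplus> u\<close> lie in the same coset, and \<open>saturation_small\<close> puts a saturation inside
\<open>U\<^sub>0 \<oplus> H\<close>. Conversely, a saturation contains the neighbourhood it comes from.\<close>
lemma openin_coset_space_iff:
  "openin X W \<longleftrightarrow> W \<subseteq> \<pi> ` G \<and>
     (\<forall>a\<in>G. \<pi> a \<in> W \<longrightarrow>
        (\<exists>U. symmetric_nbhd U \<and> (\<forall>b\<in>G. neg a \<oplus> b \<in> saturation U \<longrightarrow> \<pi> b \<in> W)))"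
  (is "_ \<longleftrightarrow> _ \<and> (\<forall>a\<in>G. _ \<longrightarrow> ?nbhd a)")
proof (intro iffI conjI ballI impI)
  assume W: "openin X W"
  then show "W \<subseteq> \<pi> ` G" by (simp add: openin_coset_space)
  fix a assume a: "a \<in> G" "\<pi> a \<in> W"
  let ?P = "{a \<in> G. \<pi> a \<in> W}"
  have "openin T ?P" using W by (simp add: openin_coset_space)
  then obtain U0 where U0: "neighbourhood_of T zero U0" "\<And>u. u \<in> U0 \<Longrightarrow> a \<oplus> u \<in> ?P"
    using neighbourhood_translate [of ?P a] a by blast
  obtain U where U: "symmetric_nbhd U" "saturation U \<subseteq> U0 \<boxplus> H"
    using saturation_small U0 by blast
  have "\<pi> b \<in> W" if b: "b \<in> G" "neg a \<oplus> b \<in> saturation U" for b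
  proof -
    obtain u h where uh: "neg a \<oplus> b = u \<oplus> h" "u \<in> U0" "h \<in> H"
      using U b by (blast elim: sum_of_setsE)
    have G: "u \<in> G" "h \<in> G" using uh U0 H_subset unfolding neighbourhood_of_def by auto
    have "b = a \<oplus> (u \<oplus> h)" using add_neg_cancel [of a b] a b uh by simp
    then have b': "b = (a \<oplus> u) \<oplus> gyr a u h" using a G by (simp add: left_gyroassoc)
    have "gyr a u h \<in> H" using a G uh H_invariant by (simp add: invariant_mem_iff)
    moreover have "neg (a \<oplus> u) \<oplus> b = gyr a u h"
      unfolding b' using a G by (simp add: neg_add_cancel gyr_closed add_closed)
    ultimately have "\<pi> (a \<oplus> u) = \<pi> b"
      using a b G by (simp add: coset_eq_iff add_closed)
    then show ?thesis using U0(2) [OF uh(2)] by simp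
  qed
  then show "?nbhd a" using U by blast
next
  assume W: "W \<subseteq> \<pi> ` G \<and> (\<forall>a\<in>G. \<pi> a \<in> W \<longrightarrow> ?nbhd a)"
  let ?P = "{a \<in> G. \<pi> a \<in> W}"
  have "\<exists>O1. openin T O1 \<and> a \<in> O1 \<and> O1 \<subseteq> ?P" if a: "a \<in> ?P" for a
  proof -
    have "a \<in> G" "\<pi> a \<in> W" using a by auto
    with W have "?nbhd a" by simp
    then obtain U where U: "symmetric_nbhd U" "\<And>b. \<lbrakk>b \<in> G; neg a \<oplus> b \<in> saturation U\<rbrakk> \<Longrightarrow> \<pi> b \<in> W"
      by blast
    obtain V where V: "openin T V" "zero \<in> V" "V \<subseteq> U"
      using U(1) unfolding symmetric_nbhd_def neighbourhood_of_def by blast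
    have "openin T {b \<in> G. neg a \<oplus> b \<in> V}"
      using continuous_left_translation [of "neg a"] a V(1)
      by (simp add: neg_closed openin_continuous_map_preimage)
    moreover have "a \<in> {b \<in> G. neg a \<oplus> b \<in> V}" using a V left_neg by simp
    moreover have "{b \<in> G. neg a \<oplus> b \<in> V} \<subseteq> ?P"
      using U V subset_saturation [of U] symmetric_nbhd_subset [of U] by blast
    ultimately show ?thesis by blast
  qed
  then have "openin T ?P" by (subst openin_subopen) blast
  with W show "openin X W" by (simp add: openin_coset_space)
qed

text \<open>The interior of a uniform ball consists of the points that have a uniform ball of their own inside
it. This set is open by halving a saturation.\<close>
lemma coset_ball_neighbourhood:
  assumes U: "symmetric_nbhd U" and a: "a \<in> G"
  shows "neighbourhood_of X (\<pi> a) {\<pi> b | b. b \<in> G \<and> neg a \<oplus> b \<in> saturation U}"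
    (is "neighbourhood_of X _ ?B")
proof -
  define inner where "inner = (\<lambda>b. \<exists>V. symmetric_nbhd V \<and>
     (\<forall>c\<in>G. neg b \<oplus> c \<in> saturation V \<longrightarrow> neg a \<oplus> c \<in> saturation U))"
  define I where "I = {\<pi> b | b. b \<in> G \<and> inner b}"
  have "openin X I"
    unfolding openin_coset_space_iff
  proof (intro conjI ballI impI)
    show "I \<subseteq> \<pi> ` G" unfolding I_def by blast
    fix b' assume b': "b' \<in> G" "\<pi> b' \<in> I"
    then obtain b where b: "b \<in> G" "\<pi> b' = \<pi> b" "inner b" unfolding I_def by blast
    obtain V where V: "symmetric_nbhd V"
      "\<And>c. \<lbrakk>c \<in> G; neg b \<oplus> c \<in> saturation V\<rbrakk> \<Longrightarrow> neg a \<oplus> c \<in> saturation U"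
      using b(3) unfolding inner_def by blast
    obtain V' where V': "symmetric_nbhd V'" "saturation V' \<boxplus> saturation V' \<subseteq> saturation V"
      using saturation_halve V by blast
    have inv: "invariant V'" using V' symmetric_nbhd_invariant by blast
    have "\<pi> c \<in> I" if c: "c \<in> G" "neg b' \<oplus> c \<in> saturation V'" for c
    proof -
      have bc: "neg b \<oplus> c \<in> saturation V'"
        using saturation_cong [OF b'(1) b(1) c(1) c(1) inv b(2) refl c(2)] .
      have "neg a \<oplus> d \<in> saturation U" if "d \<in> G" "neg c \<oplus> d \<in> saturation V'" for d
        using saturation_trans [OF b(1) c(1) that(1) inv inv bc that(2)] V V' that(1) by blast
      then have "inner c" unfolding inner_def using V' by blast
      then show ?thesis unfolding I_def using c by blast
    qed
    then show "\<exists>U. symmetric_nbhd U \<and> (\<forall>c\<in>G. neg b' \<oplus> c \<in> saturation U \<longrightarrow> \<pi> c \<in> I)"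
      using V' by blast
  qed
  moreover have "\<pi> a \<in> I" unfolding I_def inner_def using a U by blast
  moreover have "I \<subseteq> ?B"
  proof
    fix w assume "w \<in> I"
    then obtain b V where b: "w = \<pi> b" "b \<in> G" and V: "symmetric_nbhd V"
      "\<And>c. \<lbrakk>c \<in> G; neg b \<oplus> c \<in> saturation V\<rbrakk> \<Longrightarrow> neg a \<oplus> c \<in> saturation U"
      unfolding I_def inner_def by blast
    have "neg a \<oplus> b \<in> saturation U"
      using V(2) [OF b(2)] zero_saturation [OF V(1)] left_neg [OF b(2)] by simp
    then show "w \<in> ?B" using b by blast
  qed
  moreover have "?B \<subseteq> topspace X" unfolding topspace_coset_space by blast
  ultimately show ?thesis unfolding neighbourhood_of_def by blast
qed

text \<open>The preimage of the coset of \<open>a\<close> is that of the closed set \<open>H\<close> under the left translation by \<open>\<ominus>a\<close>.\<close>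
lemma t1_coset_space:
  assumes "closedin T H"
  shows "t1_space X"
  unfolding t1_space_closedin_singleton
proof
  fix w assume "w \<in> topspace X"
  then obtain a where a: "w = \<pi> a" "a \<in> G" unfolding topspace_coset_space by blast
  have "{b \<in> G. \<pi> b \<in> topspace X - {w}} = G - {b \<in> G. neg a \<oplus> b \<in> H}"
    using a coset_eq_iff by (auto simp: topspace_coset_space)
  moreover have "closedin T {b \<in> G. neg a \<oplus> b \<in> H}"
    using continuous_left_translation [of "neg a"] a assms
    by (intro closedin_continuous_map_preimage) (auto simp: neg_closed)
  ultimately have "openin X (topspace X - {w})"
    unfolding openin_coset_space by (auto simp: topspace_coset_space)
  then show "closedin X {w}" using \<open>w \<in> topspace X\<close> by (simp add: closedin_def)
qed

section \<open>Metrizability of the coset space\<close>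

text \<open>From a cofinal sequence of saturations one extracts a sequence in which each threefold sum is
contained in the preceding term. This is the cube condition for the corresponding relations on cosets.\<close>
lemma metrizable_coset_space:
  assumes "closedin T H"
    and u: "\<And>n::nat. symmetric_nbhd (u n)"
    and cofinal: "\<And>U. symmetric_nbhd U \<Longrightarrow> \<exists>n. saturation (u n) \<subseteq> saturation U"
  shows "metrizable_space X"
proof -
  have step: "\<exists>W. symmetric_nbhd W \<and>
      saturation W \<boxplus> (saturation W \<boxplus> saturation W) \<subseteq> saturation V \<and>
      saturation W \<subseteq> saturation (u n)"
    if V: "symmetric_nbhd V" for V n
  proof -
    obtain V1 where V1: "symmetric_nbhd V1" "saturation V1 \<boxplus> saturation V1 \<subseteq> saturation V"
      using saturation_halve V by blast
    obtain V2 where V2: "symmetric_nbhd V2" "saturation V2 \<boxplus> saturation V2 \<subseteq> saturation V1"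
      using saturation_halve V1 by blast
    have "neighbourhood_of T zero (V1 \<inter> (V2 \<inter> u n))"
      by (intro neighbourhood_Int symmetric_nbhd_neighbourhood V1(1) V2(1) u)
    then obtain W where W: "symmetric_nbhd W" "W \<subseteq> V1 \<inter> (V2 \<inter> u n)"
      by (rule symmetric_nbhd_exists)
    then have sub: "saturation W \<subseteq> saturation V1" "saturation W \<subseteq> saturation V2"
      "saturation W \<subseteq> saturation (u n)"
      by (auto intro!: saturation_mono)
    have "saturation W \<boxplus> (saturation W \<boxplus> saturation W) \<subseteq> saturation V1 \<boxplus> saturation V1"
      using sub sum_of_sets_mono [OF sub(2) sub(2)] V2 by (intro sum_of_sets_mono) auto
    also note V1(2)
    finally show ?thesis using W(1) sub(3) by blast
  qed
  have "\<exists>v. \<forall>n. symmetric_nbhd (v n) \<and>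
      (saturation (v (Suc n)) \<boxplus> (saturation (v (Suc n)) \<boxplus> saturation (v (Suc n))) \<subseteq> saturation (v n) \<and>
       saturation (v (Suc n)) \<subseteq> saturation (u n))"
  proof (rule dependent_nat_choice)
    show "\<exists>V. symmetric_nbhd V" using u by blast
  qed (rule step)
  then obtain v where v: "symmetric_nbhd (v n)"
      "saturation (v (Suc n)) \<boxplus> (saturation (v (Suc n)) \<boxplus> saturation (v (Suc n))) \<subseteq> saturation (v n)"
      "saturation (v (Suc n)) \<subseteq> saturation (u n)" for n
    by blast
  have inv: "invariant (v n)" for n using v(1) by (rule symmetric_nbhd_invariant)
  define R where "R = (\<lambda>n. {(\<pi> a, \<pi> b) | a b. a \<in> G \<and> b \<in> G \<and> neg a \<oplus> b \<in> saturation (v n)})"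
  have R_iff: "(\<pi> a, \<pi> b) \<in> R n \<longleftrightarrow> neg a \<oplus> b \<in> saturation (v n)" if "a \<in> G" "b \<in> G" for a b n
    using that saturation_cong [OF _ _ _ _ inv] unfolding R_def by blast
  have R_sub: "R n \<subseteq> topspace X \<times> topspace X" for n
    unfolding R_def topspace_coset_space by blast
  show ?thesis
  proof (rule metrizable_space_entourages [of X R])
    show "t1_space X" using assms(1) by (rule t1_coset_space)
    show "(x, x) \<in> R n" if "x \<in> topspace X" for n x
      using that R_iff left_neg zero_saturation [OF v(1)] by (auto simp: topspace_coset_space)
    show "(y, x) \<in> R n" if xy: "(x, y) \<in> R n" for n x y
    proof -
      obtain a b where ab: "x = \<pi> a" "y = \<pi> b" "a \<in> G" "b \<in> G" "neg a \<oplus> b \<in> saturation (v n)"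
        using xy unfolding R_def by blast
      then have "neg b \<oplus> a \<in> saturation (v n)"
        using difference_commute saturation_invariant [OF inv] saturation_symmetric [OF v(1)] by blast
      then show ?thesis using ab R_iff by simp
    qed
    show "(x, w) \<in> R n" if xyzw: "(x, y) \<in> R (Suc n)" "(y, z) \<in> R (Suc n)" "(z, w) \<in> R (Suc n)"
      for n x y z w
    proof -
      have "x \<in> \<pi> ` G" "y \<in> \<pi> ` G" "z \<in> \<pi> ` G" "w \<in> \<pi> ` G"
        using xyzw [THEN R_sub [THEN subsetD]] by (simp_all add: topspace_coset_space)
      then obtain a b c d where G: "a \<in> G" "b \<in> G" "c \<in> G" "d \<in> G"
        and eq: "x = \<pi> a" "y = \<pi> b" "z = \<pi> c" "w = \<pi> d"
        by (elim imageE)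
      have inv': "invariant (saturation (v (Suc n)))" by (rule saturation_invariant [OF inv])
      have ab: "neg a \<oplus> b \<in> saturation (v (Suc n))" and bc: "neg b \<oplus> c \<in> saturation (v (Suc n))"
        and cd: "neg c \<oplus> d \<in> saturation (v (Suc n))"
        using xyzw G unfolding eq by (simp_all add: R_iff)
      have "neg b \<oplus> d \<in> saturation (v (Suc n)) \<boxplus> saturation (v (Suc n))"
        using difference_trans [OF G(2-4) bc cd inv'] .
      then have "neg a \<oplus> d \<in> saturation (v (Suc n)) \<boxplus> (saturation (v (Suc n)) \<boxplus> saturation (v (Suc n)))"
        by (rule difference_trans [OF G(1,2,4) ab _ invariant_sum_of_sets [OF inv' inv']])
      then show ?thesis using v(2) [of n] by (auto simp: eq R_iff [OF G(1,4)])
    qed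
    show "R n \<subseteq> topspace X \<times> topspace X" for n by (rule R_sub)
    show "openin X W \<longleftrightarrow> W \<subseteq> topspace X \<and> (\<forall>x\<in>W. \<exists>n. R n `` {x} \<subseteq> W)" for W
    proof -
      have balls: "(\<exists>U. symmetric_nbhd U \<and> (\<forall>b\<in>G. neg a \<oplus> b \<in> saturation U \<longrightarrow> \<pi> b \<in> W))
          \<longleftrightarrow> (\<exists>n. R n `` {\<pi> a} \<subseteq> W)" if a: "a \<in> G" for a
      proof
        assume "\<exists>U. symmetric_nbhd U \<and> (\<forall>b\<in>G. neg a \<oplus> b \<in> saturation U \<longrightarrow> \<pi> b \<in> W)"
        then obtain U where U: "symmetric_nbhd U"
          "\<And>b. \<lbrakk>b \<in> G; neg a \<oplus> b \<in> saturation U\<rbrakk> \<Longrightarrow> \<pi> b \<in> W" by blast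
        obtain n where n: "saturation (u n) \<subseteq> saturation U" using cofinal U by blast
        \<comment> \<open>The term \<open>v (Suc n)\<close> is the one chosen below \<open>u n\<close>.\<close>
        have "R (Suc n) `` {\<pi> a} \<subseteq> W"
        proof
          fix y assume y: "y \<in> R (Suc n) `` {\<pi> a}"
          then have "y \<in> \<pi> ` G" using R_sub [of "Suc n"] by (auto simp: topspace_coset_space)
          then obtain b where b: "y = \<pi> b" "b \<in> G" by blast
          then have "neg a \<oplus> b \<in> saturation (v (Suc n))" using y a R_iff by simp
          then have "neg a \<oplus> b \<in> saturation U" using v(3) [of n] n by auto
          then show "y \<in> W" using U(2) b by simp
        qed
        then show "\<exists>n. R n `` {\<pi> a} \<subseteq> W" by blast
      next
        assume "\<exists>n. R n `` {\<pi> a} \<subseteq> W"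
        then obtain n where "R n `` {\<pi> a} \<subseteq> W" by blast
        then have "\<forall>b\<in>G. neg a \<oplus> b \<in> saturation (v n) \<longrightarrow> \<pi> b \<in> W"
          using R_iff [OF a] by auto
        then show "\<exists>U. symmetric_nbhd U \<and> (\<forall>b\<in>G. neg a \<oplus> b \<in> saturation U \<longrightarrow> \<pi> b \<in> W)"
          using v(1) by blast
      qed
      have "(\<forall>a\<in>G. \<pi> a \<in> W \<longrightarrow> P (\<pi> a)) \<longleftrightarrow> (\<forall>x\<in>W. P x)" if "W \<subseteq> \<pi> ` G" for P
        using that by blast
      from this [of "\<lambda>x. \<exists>n. R n `` {x} \<subseteq> W"] show ?thesis
        by (simp add: openin_coset_space_iff topspace_coset_space balls cong: conj_cong)
    qed
  qed
qed

end

context neutral_coset_space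
begin

lemma neg_zero_add: "b \<in> G \<Longrightarrow> neg zero \<oplus> b = b"
  using neg_unique [OF zero_closed zero_closed] left_zero zero_closed by simp

text \<open>A point in the closure is joined by a \<open>saturation V\<close> step to a point of \<open>N\<close>, which is joined to
\<open>0\<close> by another such step.\<close>
lemma closure_of_image_saturation:
  assumes V: "symmetric_nbhd V" and N: "N \<subseteq> \<pi> ` saturation V"
    and p: "p \<in> G" "\<pi> p \<in> X closure_of N"
  shows "p \<in> saturation V \<boxplus> saturation V"
proof -
  have inv: "invariant V" using V by (rule symmetric_nbhd_invariant)
  obtain W where W: "openin X W" "\<pi> p \<in> W"
    "W \<subseteq> {\<pi> b | b. b \<in> G \<and> neg p \<oplus> b \<in> saturation V}"
    using coset_ball_neighbourhood [OF V p(1)] unfolding neighbourhood_of_def by auto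
  then obtain y where y: "y \<in> N" "y \<in> W" using p(2) by (auto simp: in_closure_of)
  obtain b where b: "y = \<pi> b" "b \<in> G" "neg p \<oplus> b \<in> saturation V"
    using subsetD [OF W(3) y(2)] by auto
  obtain c where c: "y = \<pi> c" "c \<in> saturation V" using subsetD [OF N y(1)] by auto
  have cG: "c \<in> G" using c(2) invariant_subset [OF saturation_invariant [OF inv]] by auto
  have "neg zero \<oplus> b \<in> saturation V"
  proof (rule saturation_cong [OF zero_closed zero_closed cG b(2) inv refl])
    show "\<pi> c = \<pi> b" using b c by simp
    show "neg zero \<oplus> c \<in> saturation V" using c cG by (simp add: neg_zero_add)
  qed
  moreover have "neg b \<oplus> p \<in> saturation V"
    using saturation_symmetric [OF V]
    by (rule difference_commute [OF p(1) b(2,3) saturation_invariant [OF inv]])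
  ultimately have "neg zero \<oplus> p \<in> saturation V \<boxplus> saturation V"
    by (rule saturation_trans [OF zero_closed b(2) p(1) inv inv])
  then show ?thesis using p(1) by (simp add: neg_zero_add)
qed

text \<open>The use of the Baire property. The network members inside the image of \<open>saturation V\<close> cover an open
set, so the closure of one of them has interior points. Differences of points over this closure are
sums of four elements of \<open>saturation V\<close>, hence the halving is done twice.\<close>
lemma cn_network_small_difference:
  assumes baire: "baire_space X"
    and \<N>: "countable \<N>" "cn_network_at X (\<pi> zero) \<N>"
    and U: "symmetric_nbhd U"
  obtains N where "N \<in> \<N>" "X interior_of (X closure_of N) \<noteq> {}"
    "\<And>p q. \<lbrakk>p \<in> G; q \<in> G; \<pi> p \<in> X closure_of N; \<pi> q \<in> X closure_of N\<rbrakk>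
       \<Longrightarrow> neg p \<oplus> q \<in> saturation U"
proof -
  obtain V2 where V2: "symmetric_nbhd V2" "saturation V2 \<boxplus> saturation V2 \<subseteq> saturation U"
    by (rule saturation_halve [OF U])
  obtain V where V: "symmetric_nbhd V" "saturation V \<boxplus> saturation V \<subseteq> saturation V2"
    by (rule saturation_halve [OF V2(1)])
  let ?\<M> = "{N \<in> \<N>. \<pi> zero \<in> N \<and> N \<subseteq> \<pi> ` saturation V}"
  have "saturation V \<subseteq> G"
    by (intro invariant_subset saturation_invariant symmetric_nbhd_invariant V(1))
  then have "{b \<in> G. neg zero \<oplus> b \<in> saturation V} = saturation V"
    by (auto simp: neg_zero_add)
  then have "{\<pi> b | b. b \<in> G \<and> neg zero \<oplus> b \<in> saturation V} = \<pi> ` saturation V"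
    by (simp only: image_Collect [symmetric] Setcompr_eq_image)
  then have "neighbourhood_of X (\<pi> zero) (\<pi> ` saturation V)"
    using coset_ball_neighbourhood [OF V(1) zero_closed] by simp
  then have "neighbourhood_of X (\<pi> zero) (\<Union>?\<M>)" using \<N>(2) by (simp add: cn_network_at_def)
  then obtain W where W: "openin X W" "\<pi> zero \<in> W" "W \<subseteq> \<Union>?\<M>"
    unfolding neighbourhood_of_def by auto
  have "\<N> \<subseteq> Pow (topspace X)" using \<N>(2) by (simp only: cn_network_at_def)
  then have sub: "N \<subseteq> topspace X" if "N \<in> ?\<M>" for N using that by auto
  have countable: "countable ?\<M>" using \<N>(1) by simp
  have ne: "W \<noteq> {}" using W(2) by auto
  obtain N where N: "N \<in> ?\<M>" and int: "X interior_of (X closure_of N) \<noteq> {}"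
    by (rule baire_space_interior_closure [OF baire countable W(1) ne W(3) sub]) (assumption, rule that)
  have near: "p \<in> saturation V2" if "p \<in> G" "\<pi> p \<in> X closure_of N" for p
    using closure_of_image_saturation [OF V(1) _ that] N V(2) by auto
  have diff: "neg p \<oplus> q \<in> saturation U"
    if "p \<in> G" "q \<in> G" "\<pi> p \<in> X closure_of N" "\<pi> q \<in> X closure_of N" for p q
    using sum_of_setsI [OF saturation_symmetric [OF V2(1) near [OF that(1,3)]] near [OF that(2,4)]]
      V2(2) by auto
  show thesis using N int by (intro that [of N] diff) simp_all
qed

text \<open>Left translation by \<open>\<ominus>p\<close> moves the preimage of an open set to a neighbourhood of \<open>0\<close> when \<open>p\<close> lies
in that preimage.\<close>
lemma symmetric_nbhd_difference:
  assumes "openin X O1" "O1 \<noteq> {}"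
  obtains U where "symmetric_nbhd U"
    "\<And>u. u \<in> U \<Longrightarrow> \<exists>p\<in>G. \<exists>q\<in>G. \<pi> p \<in> O1 \<and> \<pi> q \<in> O1 \<and> u = neg p \<oplus> q"
proof -
  let ?P = "{a \<in> G. \<pi> a \<in> O1}"
  have P: "O1 \<subseteq> \<pi> ` G" "openin T ?P" using assms(1) by (simp_all add: openin_coset_space)
  obtain p where p: "p \<in> ?P" using assms(2) P(1) by auto
  obtain U0 where U0: "neighbourhood_of T zero U0" "\<And>u. u \<in> U0 \<Longrightarrow> p \<oplus> u \<in> ?P"
    using neighbourhood_translate [OF P(2) p] by metis
  obtain U where U: "symmetric_nbhd U" "U \<subseteq> U0" by (rule symmetric_nbhd_exists [OF U0(1)])
  show thesis
  proof
    show "symmetric_nbhd U" by fact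
    fix u assume "u \<in> U"
    then have "u = neg p \<oplus> (p \<oplus> u)"
      using p symmetric_nbhd_subset [OF U(1)] by (simp add: neg_add_cancel subset_iff)
    moreover have "p \<oplus> u \<in> ?P" using U0(2) U(2) \<open>u \<in> U\<close> by auto
    ultimately show "\<exists>p\<in>G. \<exists>q\<in>G. \<pi> p \<in> O1 \<and> \<pi> q \<in> O1 \<and> u = neg p \<oplus> q" using p by auto
  qed
qed

text \<open>For each network member \<open>N\<close> whose closure has interior, choose a neighbourhood \<open>f N\<close> of \<open>0\<close> consisting
of differences over this interior. These countably many neighbourhoods are cofinal: if such differences
lie in \<open>saturation U\<close>, then so does \<open>saturation (f N)\<close>, because \<open>saturation U\<close> absorbs \<open>H\<close> on both
sides.\<close>
lemma metrizable_of_cn_network: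
  assumes closed: "closedin T H" and baire: "baire_space X"
    and \<N>: "countable \<N>" "cn_network_at X (\<pi> zero) \<N>"
  shows "metrizable_space X"
proof -
  let ?int = "\<lambda>N. X interior_of (X closure_of N)"
  define \<N>' where "\<N>' = {N \<in> \<N>. ?int N \<noteq> {}}"
  have "\<exists>U. symmetric_nbhd U \<and>
      (\<forall>u\<in>U. \<exists>p\<in>G. \<exists>q\<in>G. \<pi> p \<in> ?int N \<and> \<pi> q \<in> ?int N \<and> u = neg p \<oplus> q)"
    if "N \<in> \<N>'" for N
  proof -
    have ne: "?int N \<noteq> {}" using that by (simp add: \<N>'_def)
    obtain U where "symmetric_nbhd U"
      "\<And>u. u \<in> U \<Longrightarrow> \<exists>p\<in>G. \<exists>q\<in>G. \<pi> p \<in> ?int N \<and> \<pi> q \<in> ?int N \<and> u = neg p \<oplus> q"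
      by (rule symmetric_nbhd_difference [OF openin_interior_of ne]) (rule that)
    then show ?thesis by auto
  qed
  then obtain f where f: "\<And>N. N \<in> \<N>' \<Longrightarrow> symmetric_nbhd (f N)"
    "\<And>N u. \<lbrakk>N \<in> \<N>'; u \<in> f N\<rbrakk>
       \<Longrightarrow> \<exists>p\<in>G. \<exists>q\<in>G. \<pi> p \<in> ?int N \<and> \<pi> q \<in> ?int N \<and> u = neg p \<oplus> q"
    by metis
  have small: "\<exists>N\<in>\<N>'. saturation (f N) \<subseteq> saturation U" if U: "symmetric_nbhd U" for U
  proof -
    have inv: "invariant U" using U by (rule symmetric_nbhd_invariant)
    obtain N where N: "N \<in> \<N>" "?int N \<noteq> {}"
      and diff: "\<And>p q. \<lbrakk>p \<in> G; q \<in> G; \<pi> p \<in> X closure_of N; \<pi> q \<in> X closure_of N\<rbrakk>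
                   \<Longrightarrow> neg p \<oplus> q \<in> saturation U"
      by (rule cn_network_small_difference [OF baire \<N> U]) (rule that)
    have N': "N \<in> \<N>'" using N by (simp add: \<N>'_def)
    have "f N \<subseteq> saturation U"
    proof
      fix u assume "u \<in> f N"
      then obtain p q where pq: "p \<in> G" "q \<in> G" "\<pi> p \<in> ?int N" "\<pi> q \<in> ?int N" "u = neg p \<oplus> q"
        using f(2) [OF N'] by metis
      then show "u \<in> saturation U"
        using diff [OF pq(1,2)] interior_of_subset [of X "X closure_of N"] by (simp add: subset_iff)
    qed
    then have "saturation (f N) \<subseteq> H \<boxplus> (saturation U \<boxplus> H)"
      unfolding saturation_def [of "f N"] by (intro sum_of_sets_mono order_refl)
    also have "\<dots> = saturation U"
      by (simp add: saturation_absorbs_left saturation_absorbs_right inv)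
    finally show ?thesis using N' by (rule bexI)
  qed
  have "neighbourhood_of T zero G" using zero_closed by (intro openin_neighbourhood) auto
  then obtain U1 where "symmetric_nbhd U1" by (rule symmetric_nbhd_exists)
  then have ne: "\<N>' \<noteq> {}" using small by auto
  have "countable \<N>'" using \<N>(1) by (simp add: \<N>'_def)
  then have enum: "range (from_nat_into \<N>') = \<N>'" using ne by (simp add: range_from_nat_into)
  show ?thesis
  proof (rule metrizable_coset_space [OF closed])
    show "symmetric_nbhd (f (from_nat_into \<N>' n))" for n
      by (rule f(1) [OF from_nat_into [OF ne]])
    fix U assume U: "symmetric_nbhd U"
    obtain N where N: "N \<in> \<N>'" "saturation (f N) \<subseteq> saturation U" using small [OF U] by (rule bexE)
    then obtain n where "N = from_nat_into \<N>' n" using enum by (metis rangeE)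
    then show "\<exists>n. saturation (f (from_nat_into \<N>' n)) \<subseteq> saturation U" using N(2) by auto
  qed
qed

end

theorem theorem5p11:
  fixes T :: "'a topology"
    and add :: "'a \<Rightarrow> 'a \<Rightarrow> 'a"
    and zero :: 'a
    and neg :: "'a \<Rightarrow> 'a"
    and gyr :: "'a \<Rightarrow> 'a \<Rightarrow> 'a \<Rightarrow> 'a"
    and H :: "'a set"
  assumes "strongly_topological_gyrogroup T add zero neg gyr"
    and "strong_subgyrogroup (topspace T) add neg gyr H"
    and "closedin T H"
    and "neutral_in T add zero H"
    and "baire_space (coset_space T add H)"
  shows "(metrizable_space (coset_space T add H) \<longleftrightarrow> strong_Pytkeev_property (coset_space T add H)) \<and>
         (metrizable_space (coset_space T add H) \<longleftrightarrow> countable_ck_character (coset_space T add H)) \<and>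
         (metrizable_space (coset_space T add H) \<longleftrightarrow> countable_cn_character (coset_space T add H)) \<and>
         (metrizable_space (coset_space T add H) \<longleftrightarrow> has_omega_base_D (coset_space T add H))"
proof -
  let ?X = "coset_space T add H"
  interpret neutral_coset_space T add zero neg gyr H
    by (intro neutral_coset_space.intro neutral_coset_space_axioms.intro assms(1,2,4))
  let ?x = "left_coset add H zero"
  have x: "?x \<in> topspace ?X" using zero_closed by (simp add: topspace_coset_space)
  have metrizable: "metrizable_space ?X" if "\<exists>\<N>. countable \<N> \<and> cn_network_at ?X ?x \<N>"
    using that by (elim exE conjE) (rule metrizable_of_cn_network [OF assms(3,5)])
  have of_Pytkeev: "metrizable_space ?X" if "strong_Pytkeev_property ?X"
    using cn_network_strong_Pytkeev [OF that x] by (rule metrizable)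
  have of_cn: "metrizable_space ?X" if "countable_cn_character ?X"
    using that x by (intro metrizable) (simp add: countable_cn_character_def)
  have cn_of_ck: "countable_cn_character ?X" if "countable_ck_character ?X"
    using that cn_network_ck [of ?X] unfolding countable_ck_character_def countable_cn_character_def
    by metis
  have of_omega: "metrizable_space ?X" if base: "has_omega_base_D ?X"
  proof -
    obtain U where "omega_base_at ?X ?x U" "condition_D U"
      using bspec [OF base [unfolded has_omega_base_D_def] x] by (elim exE conjE)
    then show ?thesis using cn_network_omega_base by (intro metrizable)
  qed
  have ck: "countable_ck_character ?X" if "metrizable_space ?X"
    using that by (rule metrizable_imp_countable_ck_character)
  show ?thesis
  proof (intro conjI iffI)
    assume "metrizable_space ?X"
    then show "strong_Pytkeev_property ?X" "countable_ck_character ?X" "countable_cn_character ?X"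
      "has_omega_base_D ?X"
      by (auto intro: metrizable_imp_strong_Pytkeev ck cn_of_ck metrizable_imp_has_omega_base_D)
  qed (auto intro: of_Pytkeev of_cn cn_of_ck of_omega)
qed

end
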